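(* Let $G$ be a finite simple graph with independence number three, with independence polynomial $I_G(z)=1+a_1z+a_2z^2+a_3z^3$, and suppose $a_2^2>3a_1a_3$. (1) If $a_2^2<4a_3(a_1-1)$, then $\mathcal{A}(G)$ is totally disconnected. (2) If $a_2^2=4a_3(a_1-1)$, then $\mathcal{A}(G)$ is connected when $a_1=5$, and is disconnected but not totally disconnected for every other value of $a_1$.
   Context: An independent set in a simple graph $G$ is a set of pairwise non-adjacent vertices; the independence number is the largest size of an independent set. The independence polynomial is $I_G(z)=\sum_{i=0}^{d}a_iz^i$ with $a_0=1$, where $a_i$ is the number of independent sets with exactly $i$ elements and $d$ is the independence number. The lexicographic product of $G$ with itself has vertex set $V(G)\times V(G)$, with $(a,x)$ adjacent to $(b,y)$ iff $a$ is adjacent to $b$ in $G$, or $a=b$ and $x$ is adjacent to $y$ in $G$; $G^m$ denotes the $m$-fold lexicographic product of $G$ with itself. For a polynomial $f$, $\mathrm{Roots}(f)=\{z: f(z)=0\}$. The independence attractor is $\mathcal{A}(G)=\lim_{m\to\infty}\mathrm{Roots}(I_{G^m})$ in the Hausdorff metric on compact subsets of $\mathbb{C}$. A set is totally disconnected if each of its connected components is a single point. *)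

theory Defs
  imports "Graph_Theory.Pair_Digraph" "HOL-Analysis.Analysis"
    "HOL-Computational_Algebra.Polynomial"
begin

text \<open>A finite simple graph is a \<^const>\<open>pair_graph\<close>: finite, symmetric and loop-free, with
  arcs given as ordered pairs of vertices.\<close>

definition independent_sets :: "'a pair_pre_digraph \<Rightarrow> 'a set set" where
  "independent_sets G = {S. S \<subseteq> pverts G \<and> (\<forall>u\<in>S. \<forall>v\<in>S. (u, v) \<notin> parcs G)}"

definition independence_number :: "'a pair_pre_digraph \<Rightarrow> nat" where
  "independence_number G = Max (card ` independent_sets G)"

definition independence_poly :: "'a pair_pre_digraph \<Rightarrow> complex poly" where
  "independence_poly G =
     (\<Sum>i\<le>independence_number G. monom (of_nat (card {S \<in> independent_sets G. card S = i})) i)"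

definition lex_prod ::
    "'a pair_pre_digraph \<Rightarrow> 'b pair_pre_digraph \<Rightarrow> ('a \<times> 'b) pair_pre_digraph" where
  "lex_prod G H =
     \<lparr> pverts = pverts G \<times> pverts H,
       parcs = {((a, x), (b, y)) | a x b y.
         (a, x) \<in> pverts G \<times> pverts H \<and> (b, y) \<in> pverts G \<times> pverts H \<and>
         ((a, b) \<in> parcs G \<or> a = b \<and> (x, y) \<in> parcs H)} \<rparr>"

definition relabel :: "('a \<Rightarrow> 'b) \<Rightarrow> 'a pair_pre_digraph \<Rightarrow> 'b pair_pre_digraph" where
  "relabel f G = \<lparr> pverts = f ` pverts G, parcs = map_prod f f ` parcs G \<rparr>"

text \<open>To have all lexicographic powers over one vertex type, a vertex of the \<open>m\<close>-th power is a list
  of length \<open>m\<close>: the pair \<open>(a, x)\<close> is renamed injectively to \<open>a # x\<close>. The product is associative up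
  to isomorphism, so the bracketing is immaterial. The \<open>0\<close>-th power is the one-vertex graph, the
  unit of the product; hence the first power is a relabelled copy of \<open>G\<close>.\<close>

primrec lex_power :: "'a pair_pre_digraph \<Rightarrow> nat \<Rightarrow> 'a list pair_pre_digraph" where
  "lex_power G 0 = \<lparr> pverts = {[]}, parcs = {} \<rparr>"
| "lex_power G (Suc m) = relabel (\<lambda>(a, x). a # x) (lex_prod G (lex_power G m))"

definition Roots :: "complex poly \<Rightarrow> complex set" where
  "Roots p = {z. poly p z = 0}"

text \<open>This is the Hausdorff metric on nonempty compact sets; on other arguments the suprema may
  be unspecified.\<close>

definition hausdorff_dist :: "'a::metric_space set \<Rightarrow> 'a set \<Rightarrow> real" where
  "hausdorff_dist A B = max (SUP a\<in>A. infdist a B) (SUP b\<in>B. infdist b A)"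

definition hausdorff_tendsto :: "(nat \<Rightarrow> 'a::metric_space set) \<Rightarrow> 'a set \<Rightarrow> bool" where
  "hausdorff_tendsto X A \<longleftrightarrow>
     compact A \<and> A \<noteq> {} \<and> (\<lambda>m. hausdorff_dist (X m) A) \<longlonglongrightarrow> 0"

lemma hausdorff_dist_commute: "hausdorff_dist A B = hausdorff_dist B A"
  by (simp add: hausdorff_dist_def max.commute)

lemma infdist_le_hausdorff_dist:
  assumes "compact A" "B \<noteq> {}" "a \<in> A"
  shows "infdist a B \<le> hausdorff_dist A B"
proof -
  have "compact ((\<lambda>a. infdist a B) ` A)"
    using assms by (intro compact_continuous_image continuous_intros)
  then have "bdd_above ((\<lambda>a. infdist a B) ` A)"
    by (intro bounded_imp_bdd_above compact_imp_bounded)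
  then show ?thesis
    using assms by (auto simp: hausdorff_dist_def intro!: max.coboundedI1 cSUP_upper)
qed

lemma hausdorff_tendsto_subset:
  fixes A B :: "'a::heine_borel set"
  assumes "hausdorff_tendsto X A" "hausdorff_tendsto X B"
    and X: "\<And>m. compact (X m)" "\<And>m. X m \<noteq> {}"
  shows "A \<subseteq> B"
proof
  fix a assume a: "a \<in> A"
  have A: "compact A" "A \<noteq> {}" and B: "compact B" "B \<noteq> {}"
    and lim: "(\<lambda>m. hausdorff_dist (X m) A) \<longlonglongrightarrow> 0" "(\<lambda>m. hausdorff_dist (X m) B) \<longlonglongrightarrow> 0"
    using assms(1,2) by (auto simp: hausdorff_tendsto_def)
  have bound: "infdist a B \<le> hausdorff_dist (X m) A + hausdorff_dist (X m) B" for m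
  proof -
    obtain x where x: "x \<in> X m" "infdist a (X m) = dist a x"
      using infdist_attains_inf[OF compact_imp_closed[OF X(1)[of m]] X(2)[of m]] by blast
    have "infdist a B \<le> infdist x B + dist a x"
      by (rule infdist_triangle)
    moreover have "dist a x \<le> hausdorff_dist (X m) A"
      using infdist_le_hausdorff_dist[OF A(1) X(2)[of m] a] x(2) by (simp add: hausdorff_dist_commute)
    moreover have "infdist x B \<le> hausdorff_dist (X m) B"
      by (rule infdist_le_hausdorff_dist[OF X(1) B(2) x(1)])
    ultimately show ?thesis by simp
  qed
  have "(\<lambda>m. hausdorff_dist (X m) A + hausdorff_dist (X m) B) \<longlonglongrightarrow> 0 + 0"
    by (intro tendsto_add lim)
  then have "infdist a B \<le> 0"
    using LIMSEQ_le_const[of _ 0 "infdist a B"] bound by auto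
  then show "a \<in> B"
    using in_closed_iff_infdist_zero[OF compact_imp_closed[OF B(1)] B(2)] infdist_nonneg[of a B]
    by auto
qed

lemma hausdorff_tendsto_unique:
  fixes A B :: "'a::heine_borel set"
  assumes "hausdorff_tendsto X A" "hausdorff_tendsto X B"
    and "\<And>m. compact (X m)" "\<And>m. X m \<noteq> {}"
  shows "A = B"
  using hausdorff_tendsto_subset assms by (metis subset_antisym)

definition has_independence_attractor :: "'a pair_pre_digraph \<Rightarrow> bool" where
  "has_independence_attractor G \<longleftrightarrow>
     (\<exists>A. hausdorff_tendsto (\<lambda>m. Roots (independence_poly (lex_power G m))) A)"

text \<open>Unspecified unless the limit exists, that is, unless \<open>has_independence_attractor G\<close>.\<close>

definition independence_attractor :: "'a pair_pre_digraph \<Rightarrow> complex set" where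
  "independence_attractor G =
     (THE A. hausdorff_tendsto (\<lambda>m. Roots (independence_poly (lex_power G m))) A)"

definition totally_disconnected :: "'a::topological_space set \<Rightarrow> bool" where
  "totally_disconnected S \<longleftrightarrow> (\<forall>C\<in>components S. \<exists>x. C = {x})"

end

theory Submission
  imports Defs "HOL-Complex_Analysis.Complex_Analysis"
    "HOL-Computational_Algebra.Fundamental_Theorem_Algebra"
begin

text \<open>Let \<open>p(z) = a1 z + a2 z^2 + a3 z^3\<close> and let \<open>K\<close> be its filled Julia set. Then
  \<open>I(G^m) = p^m + 1\<close>, so the roots are the preimages of \<open>-1\<close> under \<open>p^m\<close>. These converge to the
  Julia set, the frontier of \<open>K\<close>, as soon as \<open>-1\<close> is not an interior point of \<open>K\<close>: near the
  Julia set two values cannot be omitted infinitely often. That \<open>-1\<close> is not interior is a parity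
  argument in the parabolic case, and holds in the other case because all negative reals escape.

  If \<open>a2^2 < 4 a3 (a1 - 1)\<close>, the critical values lie on an escaping slit of the negative axis, off
  which \<open>p\<close> has three explicit holomorphic inverse branches. A connected piece of the Julia set
  with more than one point would give a nonconstant limit of compositions of these branches, which
  Montel's theorem and the open mapping theorem exclude.

  If \<open>a2^2 = 4 a3 (a1 - 1)\<close>, then \<open>p(z) = z + a3 z (z + s)^2\<close> has a parabolic fixed point \<open>-s\<close>. Its
  petal makes the interior of \<open>K\<close> nonempty, and a totally disconnected compact set does not separate
  the plane. For \<open>a1 = 5\<close> the real interval \<open>[-s, 0]\<close> contains all preimages of \<open>-s\<close>, which makes
  the preimages of a large disc connected. For \<open>a1 > 5\<close> an escaping arc of the curve on which \<open>p\<close>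
  is real separates \<open>-s\<close> from \<open>0\<close>.\<close>

section \<open>Independence polynomials of lexicographic powers\<close>

lemma finite_pverts_lex_prod:
  "finite (pverts G) \<Longrightarrow> finite (pverts H) \<Longrightarrow> finite (pverts (lex_prod G H))"
  by (simp add: lex_prod_def)

lemma finite_independent_sets:
  "finite (pverts G) \<Longrightarrow> finite (independent_sets G)"
  by (rule finite_subset[of _ "Pow (pverts G)"]) (auto simp: independent_sets_def)

lemma finite_independent_set:
  "finite (pverts G) \<Longrightarrow> S \<in> independent_sets G \<Longrightarrow> finite S"
  by (auto simp: independent_sets_def intro: finite_subset)

text \<open>Grouping by cardinality turns the coefficient sum into one weighted sum over all
  independent sets, the form in which the product formula becomes a bijection.\<close>

lemma poly_independence_poly:
  assumes "finite (pverts G)"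
  shows "poly (independence_poly G) z = (\<Sum>S\<in>independent_sets G. z ^ card S)"
proof -
  note fin = finite_independent_sets[OF assms]
  have le: "card S \<in> {..independence_number G}" if "S \<in> independent_sets G" for S
    unfolding independence_number_def atMost_iff using fin that by (intro Max_ge) auto
  have "(\<Sum>S\<in>independent_sets G. z ^ card S) =
      (\<Sum>i\<le>independence_number G. \<Sum>S\<in>{S \<in> independent_sets G. card S = i}. z ^ card S)"
    by (rule sum.group[symmetric]) (use fin le in auto)
  also have "\<dots> = (\<Sum>i\<le>independence_number G.
      of_nat (card {S \<in> independent_sets G. card S = i}) * z ^ i)"
    by (intro sum.cong refl) simp
  finally show ?thesis
    by (simp add: independence_poly_def poly_sum poly_monom)
qed

lemma independent_sets_relabel:
  assumes "inj f"
  shows "independent_sets (relabel f G) = (`) f ` independent_sets G"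
proof -
  have arc: "(f u, f v) \<in> map_prod f f ` parcs G \<longleftrightarrow> (u, v) \<in> parcs G" for u v
    using inj_image_mem_iff[OF prod.inj_map[OF assms assms], of "(u, v)"] by simp
  have "S \<in> (`) f ` independent_sets G" if S: "S \<in> independent_sets (relabel f G)" for S
  proof -
    have "S \<subseteq> f ` pverts G"
      using S by (simp add: independent_sets_def relabel_def)
    then obtain T where T: "T \<subseteq> pverts G" "S = f ` T"
      by (rule subset_imageE)
    have "T \<in> independent_sets G"
      using S T by (simp add: independent_sets_def relabel_def arc)
    then show ?thesis
      unfolding T(2) by (rule imageI)
  qed
  moreover have "f ` T \<in> independent_sets (relabel f G)" if "T \<in> independent_sets G" for T
    using that by (simp add: independent_sets_def relabel_def arc image_mono)
  ultimately show ?thesis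
    by (intro equalityI subsetI) auto
qed

lemma poly_independence_poly_relabel:
  assumes "finite (pverts G)" "inj f"
  shows "poly (independence_poly (relabel f G)) z = poly (independence_poly G) z"
proof -
  have "inj ((`) f)"
    by (rule injI) (use assms(2) in \<open>simp add: inj_image_eq_iff\<close>)
  then have inj: "inj_on ((`) f) (independent_sets G)"
    by (rule inj_on_subset) simp
  have fin: "finite (pverts (relabel f G))"
    using assms(1) by (simp add: relabel_def)
  have "card (f ` S) = card S" for S
    by (rule card_image) (rule inj_on_subset[OF assms(2) subset_UNIV])
  then show ?thesis
    unfolding poly_independence_poly[OF fin] poly_independence_poly[OF assms(1)]
      independent_sets_relabel[OF assms(2)] sum.reindex[OF inj] by simp
qed

text \<open>An independent set of \<open>G[H]\<close> is an independent set of \<open>G\<close> together with a nonempty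
  independent set of \<open>H\<close> over each of its vertices.\<close>

lemma bij_betw_independent_sets_lex_prod:
  "bij_betw (\<lambda>(S, f). Sigma S f)
    (SIGMA S:independent_sets G. PiE S (\<lambda>_. independent_sets H - {{}})) (independent_sets (lex_prod G H))"
  (is "bij_betw ?\<phi> ?X ?Y")
  unfolding bij_betw_def
proof
  have dom: "S = fst ` Sigma S f" and fib: "\<And>s. s \<in> S \<Longrightarrow> f s = Sigma S f `` {s}"
    if "(S, f) \<in> ?X" for S f
    using that by (force simp: PiE_iff)+
  show "inj_on ?\<phi> ?X"
  proof (rule inj_onI)
    fix x y assume x: "x \<in> ?X" and y: "y \<in> ?X" and xy: "?\<phi> x = ?\<phi> y"
    obtain S f T g where [simp]: "x = (S, f)" "y = (T, g)" by fastforce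
    have 1: "(S, f) \<in> ?X" and 2: "(T, g) \<in> ?X" and eq: "Sigma S f = Sigma T g"
      using x y xy by auto
    have "S = T"
      using dom[OF 1] dom[OF 2] eq by simp
    moreover have "f = g"
    proof (rule PiE_ext)
      show "f \<in> PiE S (\<lambda>_. independent_sets H - {{}})" "g \<in> PiE S (\<lambda>_. independent_sets H - {{}})"
        using 1 2 \<open>S = T\<close> by auto
      show "f s = g s" if "s \<in> S" for s
        using fib[OF 1 that] fib[OF 2] that \<open>S = T\<close> eq by simp
    qed
    ultimately show "x = y" by simp
  qed
  show "?\<phi> ` ?X = ?Y"
  proof (intro equalityI subsetI)
    fix T assume "T \<in> ?\<phi> ` ?X"
    then obtain S f where S: "S \<in> independent_sets G"
      and f: "\<And>s. s \<in> S \<Longrightarrow> f s \<in> independent_sets H" and T: "T = Sigma S f"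
      by (auto simp: PiE_iff)
    show "T \<in> ?Y"
      unfolding T independent_sets_def lex_prod_def
      using S f by (auto simp: independent_sets_def)
  next
    fix T assume T: "T \<in> ?Y"
    define S where "S = fst ` T"
    define f where "f = restrict (\<lambda>s. T `` {s}) S"
    have T1: "a \<in> pverts G" "x \<in> pverts H" if "(a, x) \<in> T" for a x
      using T that by (auto simp: independent_sets_def lex_prod_def)
    have T2: "(a, b) \<notin> parcs G" "a = b \<Longrightarrow> (x, y) \<notin> parcs H" if "(a, x) \<in> T" "(b, y) \<in> T" for a x b y
      using T that T1[OF that(1)] T1[OF that(2)] by (auto simp: independent_sets_def lex_prod_def)
    have S: "a \<in> S \<longleftrightarrow> (\<exists>x. (a, x) \<in> T)" for a
      by (force simp: S_def)
    have "S \<in> independent_sets G"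
      unfolding independent_sets_def using T1(1) T2(1) by (auto simp: S)
    moreover have "T `` {a} \<in> independent_sets H - {{}}" if "a \<in> S" for a
      unfolding independent_sets_def using T1(2) T2(2) that by (auto simp: S)
    then have "f \<in> PiE S (\<lambda>_. independent_sets H - {{}})"
      by (simp add: f_def)
    moreover have "T = Sigma S f"
      by (auto simp: f_def S)
    ultimately show "T \<in> ?\<phi> ` ?X"
      by (intro image_eqI[of _ _ "(S, f)"]) simp_all
  qed
qed

text \<open>Weights multiply: the size of \<open>Sigma S f\<close> is the sum of the
  \<open>card (f s)\<close>, so distributing the product over the inner sums leaves one term per
  independent set of the product. The \<open>- 1\<close> removes the empty set, which may not occur
  as a fibre.\<close>

lemma poly_independence_poly_lex_prod:
  assumes fin: "finite (pverts G)" "finite (pverts H)"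
  shows "poly (independence_poly (lex_prod G H)) z =
    poly (independence_poly G) (poly (independence_poly H) z - 1)"
proof -
  let ?N = "independent_sets H - {{}}"
  note finI = finite_independent_sets[OF fin(1)] finite_independent_sets[OF fin(2)]
  have finN: "finite ?N" using finI by simp
  have empty: "{} \<in> independent_sets H" by (simp add: independent_sets_def)
  have "poly (independence_poly H) z - 1 = (\<Sum>U\<in>?N. z ^ card U)"
    using fin finI empty by (simp add: poly_independence_poly sum.remove)
  then have "poly (independence_poly G) (poly (independence_poly H) z - 1) =
      (\<Sum>S\<in>independent_sets G. \<Prod>s\<in>S. \<Sum>U\<in>?N. z ^ card U)"
    using fin by (simp add: poly_independence_poly)
  also have "\<dots> = (\<Sum>S\<in>independent_sets G. \<Sum>f\<in>PiE S (\<lambda>_. ?N). \<Prod>s\<in>S. z ^ card (f s))"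
    using finite_independent_set[OF fin(1)] finN
    by (intro sum.cong refl, subst prod_sum_PiE) auto
  also have "\<dots> = (\<Sum>(S, f)\<in>(SIGMA S:independent_sets G. PiE S (\<lambda>_. ?N)). \<Prod>s\<in>S. z ^ card (f s))"
    using finI finN finite_independent_set[OF fin(1)]
    by (subst sum.Sigma) (auto intro!: finite_PiE)
  also have "\<dots> = (\<Sum>(S, f)\<in>(SIGMA S:independent_sets G. PiE S (\<lambda>_. ?N)). z ^ card (Sigma S f))"
  proof (intro sum.cong refl, clarify)
    fix S f assume S: "S \<in> independent_sets G" and f: "f \<in> PiE S (\<lambda>_. ?N)"
    have "card (Sigma S f) = (\<Sum>s\<in>S. card (f s))"
      using finite_independent_set[OF fin(1) S] finite_independent_set[OF fin(2)] f
      by (intro card_SigmaI) (auto simp: PiE_iff)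
    then show "(\<Prod>s\<in>S. z ^ card (f s)) = z ^ card (Sigma S f)"
      by (simp add: power_sum)
  qed
  also have "\<dots> = (\<Sum>T\<in>independent_sets (lex_prod G H). z ^ card T)"
    using sum.reindex_bij_betw[OF bij_betw_independent_sets_lex_prod, of "\<lambda>T. z ^ card T" G H]
    by (simp add: case_prod_unfold)
  finally show ?thesis
    using fin by (simp add: poly_independence_poly finite_pverts_lex_prod)
qed

lemma finite_pverts_lex_power: "finite (pverts G) \<Longrightarrow> finite (pverts (lex_power G m))"
  by (induction m) (auto simp: relabel_def intro: finite_pverts_lex_prod)

text \<open>Subtracting 1 turns the product formula into iteration of a single map; the one-vertex
  graph has polynomial \<open>1 + z\<close>, matching the zeroth iterate.\<close>

lemma poly_independence_poly_lex_power:
  assumes fin: "finite (pverts G)"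
  shows "poly (independence_poly (lex_power G m)) z =
    ((\<lambda>z. poly (independence_poly G) z - 1) ^^ m) z + 1"
proof (induction m)
  case 0
  have "independent_sets (lex_power G 0) = {{}, {[]}}"
    by (auto simp: independent_sets_def)
  then show ?case
    by (simp add: poly_independence_poly)
next
  case (Suc m)
  have "inj (\<lambda>(a :: 'a, x). a # x)"
    by (auto simp: inj_def)
  then show ?case
    using fin finite_pverts_lex_power[OF fin, of m] Suc
    by (simp add: poly_independence_poly_relabel finite_pverts_lex_prod
      poly_independence_poly_lex_prod)
qed

section \<open>Filled Julia sets of entire escaping maps\<close>

text \<open>A finite subcover turns locally uniform eventual statements into uniform ones.\<close>

lemma compact_eventually_ball:
  assumes "compact L"
    and local: "\<And>x. x \<in> L \<Longrightarrow> \<exists>U. open U \<and> x \<in> U \<and> (\<forall>\<^sub>F m in F. \<forall>y\<in>U. Q m y)"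
  shows "\<forall>\<^sub>F m in F. \<forall>y\<in>L. Q m y"
proof -
  obtain U where U: "\<And>x. x \<in> L \<Longrightarrow> open (U x) \<and> x \<in> U x \<and> (\<forall>\<^sub>F m in F. \<forall>y\<in>U x. Q m y)"
    using local by metis
  obtain D where D: "D \<subseteq> L" "finite D" "L \<subseteq> (\<Union>x\<in>D. U x)"
    using compactE_image[OF \<open>compact L\<close>, of L U] U by blast
  have "\<forall>\<^sub>F m in F. \<forall>x\<in>D. \<forall>y\<in>U x. Q m y"
    using D U by (intro eventually_ball_finite) auto
  then show ?thesis
    by (rule eventually_mono) (use D in blast)
qed

definition filled_julia :: "(complex \<Rightarrow> complex) \<Rightarrow> complex set" where
  "filled_julia f = {z. bounded (range (\<lambda>n. (f ^^ n) z))}"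

section \<open>Escape estimates and invariance of the filled Julia set\<close>

locale escaping =
  fixes f :: "complex \<Rightarrow> complex" and R :: real
  assumes hol: "f holomorphic_on UNIV"
    and R_pos: "0 < R"
    and escape: "\<And>z. R \<le> norm z \<Longrightarrow> 2 * norm z \<le> norm (f z)"
begin

abbreviation "K \<equiv> filled_julia f"

lemma holomorphic_funpow: "(f ^^ n) holomorphic_on S"
proof -
  have "(f ^^ n) holomorphic_on UNIV"
  proof (induction n)
    case (Suc n)
    then show ?case
      using holomorphic_on_compose[OF Suc holomorphic_on_subset[OF hol]] by (simp add: o_def)
  qed (simp add: id_def)
  then show ?thesis
    by (rule holomorphic_on_subset) simp
qed

lemma continuous_on_funpow: "continuous_on S (f ^^ n)"
  using holomorphic_funpow by (rule holomorphic_on_imp_continuous_on)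

lemma escape_funpow:
  assumes "R \<le> norm z"
  shows "2 ^ n * norm z \<le> norm ((f ^^ n) z)"
proof (induction n)
  case (Suc n)
  have "1 * norm z \<le> 2 ^ n * norm z"
    by (intro mult_right_mono) simp_all
  then have "R \<le> norm ((f ^^ n) z)"
    using assms Suc by linarith
  from escape[OF this] Suc show ?case by simp
qed simp

lemma escape_funpow_add:
  assumes "R \<le> norm ((f ^^ k) z)"
  shows "2 ^ n * R \<le> norm ((f ^^ (n + k)) z)"
proof -
  have "2 ^ n * R \<le> 2 ^ n * norm ((f ^^ k) z)"
    using assms by simp
  also have "\<dots> \<le> norm ((f ^^ (n + k)) z)"
    using escape_funpow[OF assms, of n] by (simp add: funpow_add)
  finally show ?thesis .
qed

lemma eventually_power_gt: "\<forall>\<^sub>F n in sequentially. B < 2 ^ n * R"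
proof -
  have "\<forall>\<^sub>F n in sequentially. B / R < 2 ^ n"
    using filterlim_realpow_sequentially_gt1[of "2::real"]
    by (simp add: filterlim_at_infinity_conv_norm_at_top norm_power filterlim_at_top_dense)
  then show ?thesis
    by eventually_elim (use R_pos in \<open>simp add: field_simps\<close>)
qed

lemma mem_filled_julia_iff: "z \<in> K \<longleftrightarrow> (\<forall>n. norm ((f ^^ n) z) < R)"
proof
  assume z: "z \<in> K"
  then obtain B where B: "norm ((f ^^ n) z) \<le> B" for n
    by (auto simp: filled_julia_def bounded_iff)
  show "\<forall>n. norm ((f ^^ n) z) < R"
  proof (rule ccontr)
    assume "\<not> ?thesis"
    then obtain k where k: "R \<le> norm ((f ^^ k) z)"
      by (auto simp: not_less)
    obtain n where "B < 2 ^ n * R"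
      using eventually_happens[OF eventually_power_gt] by auto
    then show False
      using escape_funpow_add[OF k, of n] B[of "n + k"] by simp
  qed
next
  assume "\<forall>n. norm ((f ^^ n) z) < R"
  then show "z \<in> K"
    by (auto simp: filled_julia_def bounded_iff intro!: exI[of _ R] less_imp_le)
qed

text \<open>One step after modulus \<open>R\<close> is reached the modulus has doubled, so the
  inequality can be taken strict. Escape thus becomes an open condition, which makes
  \<open>K\<close> closed.\<close>

lemma not_mem_filled_juliaE:
  assumes "z \<notin> K"
  obtains k where "R < norm ((f ^^ k) z)"
proof -
  obtain k where k: "R \<le> norm ((f ^^ k) z)"
    using assms by (auto simp: mem_filled_julia_iff not_less)
  have "R < norm ((f ^^ Suc k) z)"
    using escape[OF k] k R_pos by simp
  then show thesis by (rule that)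
qed

lemma closed_filled_julia: "closed K"
proof -
  have "K = (\<Inter>n. {z. norm ((f ^^ n) z) \<le> R})"
    by (auto simp: mem_filled_julia_iff less_imp_le elim!: not_mem_filled_juliaE
        dest: not_mem_filled_juliaE) (metis linorder_not_le mem_filled_julia_iff not_mem_filled_juliaE)
  moreover have "closed {z. norm ((f ^^ n) z) \<le> R}" for n
    by (intro closed_Collect_le continuous_intros continuous_on_funpow)
  ultimately show ?thesis by auto
qed

lemma norm_filled_julia_less: "z \<in> K \<Longrightarrow> norm z < R"
  using mem_filled_julia_iff[of z] by (metis funpow_0)

lemma filled_julia_neq_UNIV: "K \<noteq> UNIV"
proof -
  have "of_real R \<notin> K"
    using norm_filled_julia_less[of "of_real R"] by fastforce
  then show ?thesis by blast
qed

lemma compact_filled_julia: "compact K"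
proof -
  have "bounded K"
    by (rule boundedI[of _ R]) (rule less_imp_le[OF norm_filled_julia_less])
  then show ?thesis
    using closed_filled_julia by (simp add: compact_eq_bounded_closed)
qed

lemma compact_julia: "compact (frontier K)"
  by (rule compact_frontier) (rule compact_filled_julia)

lemma julia_subset: "frontier K \<subseteq> K"
  by (rule frontier_subset_closed) (rule closed_filled_julia)

lemma escaping_near_julia:
  assumes "z \<in> frontier K" "open U" "z \<in> U"
  obtains w where "w \<in> U" "w \<notin> K"
proof -
  have "U \<inter> closure (- K) \<noteq> {}"
    using assms by (auto simp: frontier_closures)
  then have "U \<inter> - K \<noteq> {}"
    using open_Int_closure_eq_empty[OF assms(2), of "- K"] by simp
  then show thesis
    using that by blast
qed

lemma filled_julia_step_iff: "f z \<in> K \<longleftrightarrow> z \<in> K"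
proof
  assume fz: "f z \<in> K"
  have "norm ((f ^^ n) z) < R" for n
  proof (cases n)
    case 0
    then show ?thesis
      using escape[of z] norm_filled_julia_less[OF fz] R_pos by (cases "R \<le> norm z") auto
  next
    case (Suc m)
    then show ?thesis
      using fz by (simp add: mem_filled_julia_iff funpow_Suc_right del: funpow.simps)
  qed
  then show "z \<in> K" by (simp add: mem_filled_julia_iff)
next
  assume "z \<in> K"
  then have "norm ((f ^^ Suc n) z) < R" for n
    unfolding mem_filled_julia_iff by blast
  then show "f z \<in> K"
    by (simp add: mem_filled_julia_iff funpow_Suc_right del: funpow.simps)
qed

lemma funpow_filled_julia_iff: "(f ^^ n) z \<in> K \<longleftrightarrow> z \<in> K"
  by (induction n) (simp_all add: filled_julia_step_iff)

text \<open>Exceeding \<open>R\<close> at time \<open>k\<close> is an open condition, and the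
  doubling that follows is bounded below independently of the point.\<close>

lemma escape_neighbourhood:
  assumes "z \<notin> K"
  obtains U where "open U" "z \<in> U"
    "\<forall>B. \<forall>\<^sub>F n in sequentially. \<forall>w\<in>U. B < norm ((f ^^ n) w)"
proof -
  obtain k where k: "R < norm ((f ^^ k) z)"
    using assms by (rule not_mem_filled_juliaE)
  show thesis
  proof
    show "open {w. R < norm ((f ^^ k) w)}"
      by (intro open_Collect_less continuous_intros continuous_on_funpow)
    have "\<forall>\<^sub>F n in sequentially. \<forall>w\<in>{w. R < norm ((f ^^ k) w)}. B < norm ((f ^^ n) w)" for B
    proof -
      have "\<forall>\<^sub>F n in sequentially. \<forall>w\<in>{w. R < norm ((f ^^ k) w)}. B < norm ((f ^^ (n + k)) w)"
        using eventually_power_gt[of B]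
        by eventually_elim (auto intro: less_le_trans escape_funpow_add[OF less_imp_le])
      then show ?thesis
        by (subst (asm) eventually_sequentially_seg)
    qed
    then show "\<forall>B. \<forall>\<^sub>F n in sequentially. \<forall>w\<in>{w. R < norm ((f ^^ k) w)}. B < norm ((f ^^ n) w)"
      by blast
  qed (use k in simp)
qed

lemma not_constant: "\<not> f constant_on UNIV"
proof
  assume "f constant_on UNIV"
  then obtain c where c: "\<And>z. f z = c" by (auto simp: constant_on_def)
  show False
    using escape[of "of_real (R + norm c)"] R_pos norm_ge_zero[of c]
    by (simp add: c del: of_real_add norm_ge_zero)
qed

section \<open>Convergence of iterated preimages to the Julia set\<close>

text \<open>Nonconstant holomorphic maps are open and \<open>K\<close> is forward invariant.
  Contrapositively, iterated preimages of a non-interior point are non-interior.\<close>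

lemma interior_filled_julia_step:
  assumes "z \<in> interior K"
  shows "f z \<in> interior K"
proof -
  have "open (f ` interior K)"
    using open_mapping_thm[OF hol open_UNIV connected_UNIV open_interior _ not_constant] by simp
  moreover have "f ` interior K \<subseteq> K"
    using interior_subset[of K] filled_julia_step_iff by auto
  ultimately show ?thesis
    using assms by (meson image_eqI interiorI)
qed

lemma interior_filled_julia_funpow: "z \<in> interior K \<Longrightarrow> (f ^^ n) z \<in> interior K"
  by (induction n) (simp_all add: interior_filled_julia_step)

text \<open>If the iterate \<open>f ^^ Suc m\<close> omits \<open>a\<close> on a disc, then \<open>f ^^ m\<close> omits the two values \<open>u\<close> and
  \<open>v\<close> there; by Schottky's theorem this cannot happen for infinitely many \<open>m\<close> on a disc meeting
  both \<open>K\<close> and its complement.\<close>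

lemma eventually_hits_near_julia:
  assumes z: "z \<in> frontier K" and U: "open U" "z \<in> U"
    and uv: "f u = a" "f v = a" "u \<noteq> v"
  shows "\<forall>\<^sub>F m in sequentially. \<exists>w\<in>U. (f ^^ m) w = a"
proof -
  obtain e where e: "0 < e" "ball z e \<subseteq> U"
    using U by (meson openE)
  \<comment> \<open>Affine normalization sending \<open>u\<close> and \<open>v\<close> to 0 and 1.
    The members of \<open>Y\<close> omit these two values on the disc and are bounded by
    \<open>r\<close> at its centre, whose orbit is bounded, so they are uniformly bounded near
    \<open>z\<close>.\<close>
  define h where "h n w = ((f ^^ n) w - u) / (v - u)" for n w
  define Y where "Y = h ` {n. \<forall>w\<in>ball z e. (f ^^ Suc n) w \<noteq> a}"
  define r where "r = (R + norm u) / norm (v - u)"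
  have h_bound: "norm (h n z) \<le> r" for n
  proof -
    have "norm ((f ^^ n) z) < R"
      using z julia_subset mem_filled_julia_iff by blast
    then have "norm ((f ^^ n) z - u) \<le> R + norm u"
      using norm_triangle_ineq4[of "(f ^^ n) z" u] by linarith
    then show ?thesis
      using uv by (simp add: h_def r_def norm_divide divide_right_mono)
  qed
  have omit: "(f ^^ n) w \<noteq> u \<and> (f ^^ n) w \<noteq> v" if "(f ^^ Suc n) w \<noteq> a" for n w
    using that uv by auto
  obtain B Z where B: "0 < B" and Z: "open Z" "z \<in> Z" "Z \<subseteq> ball z e"
    and le_B: "\<And>h w. \<lbrakk>h \<in> Y; w \<in> Z\<rbrakk> \<Longrightarrow> norm (h w) \<le> B"
  proof (rule GPicard1[of "ball z e" z r Y Y])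
    show "0 < r"
      using R_pos uv by (auto simp: r_def intro!: divide_pos_pos add_pos_nonneg)
    show "g holomorphic_on ball z e" if "g \<in> Y" for g
      using that uv unfolding Y_def h_def
      by (auto intro!: holomorphic_intros holomorphic_funpow)
    show "g w \<noteq> 0 \<and> g w \<noteq> 1" if "g \<in> Y" "w \<in> ball z e" for g w
      using that omit uv by (auto simp: Y_def h_def field_simps)
    show "norm (g z) \<le> r" if "g \<in> Y" for g
      using that h_bound by (auto simp: Y_def)
  qed (use e in auto)
  \<comment> \<open>At an escaping point of \<open>Z\<close> the values of \<open>h n\<close>
    eventually exceed \<open>B\<close>, so \<open>h n\<close> drops out of \<open>Y\<close> and
    \<open>f ^^ Suc n\<close> hits \<open>a\<close>.\<close>
  obtain z' where z': "z' \<in> Z" "z' \<notin> K"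
    using escaping_near_julia[OF z Z(1,2)] by blast
  obtain V where "open V" and V: "z' \<in> V"
    "\<forall>B. \<forall>\<^sub>F n in sequentially. \<forall>w\<in>V. B < norm ((f ^^ n) w)"
    using escape_neighbourhood[OF z'(2)] by blast
  have "\<forall>\<^sub>F n in sequentially. \<exists>w\<in>U. (f ^^ Suc n) w = a"
    using spec[OF V(2), of "B * norm (v - u) + norm u"]
  proof eventually_elim
    case (elim n)
    then have "B * norm (v - u) + norm u < norm ((f ^^ n) z')"
      using V(1) by blast
    then have "B * norm (v - u) < norm ((f ^^ n) z' - u)"
      using norm_triangle_sub[of "(f ^^ n) z'" u] by linarith
    then have "B < norm (h n z')"
      using uv by (simp add: h_def norm_divide field_simps)
    then have "h n \<notin> Y"
      using le_B[of "h n" z'] z'(1) by auto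
    then have "n \<notin> {n. \<forall>w\<in>ball z e. (f ^^ Suc n) w \<noteq> a}"
      unfolding Y_def by blast
    then show ?case
      using e(2) by blast
  qed
  then show ?thesis
    by (subst (asm) eventually_sequentially_Suc)
qed

text \<open>Preimages accumulate at every Julia point by \<open>eventually_hits_near_julia\<close>,
  uniformly by compactness. Conversely, preimages of \<open>a\<close> are never interior, so away
  from the Julia set they would lie outside \<open>K\<close>, where orbits leave every bounded
  set.\<close>

lemma hausdorff_tendsto_preimages:
  assumes a: "a \<notin> interior K"
    and uv: "f u = a" "f v = a" "u \<noteq> v"
    and nonempty: "K \<noteq> {}"
  shows "hausdorff_tendsto (\<lambda>m. {z. (f ^^ m) z = a}) (frontier K)"
proof -
  let ?X = "\<lambda>m. {z. (f ^^ m) z = a}" and ?J = "frontier K"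
  have J: "?J \<noteq> {}"
    using nonempty filled_julia_neq_UNIV by (rule frontier_not_empty)
  have J_near: "\<forall>\<^sub>F m in sequentially. \<forall>x\<in>?J. infdist x (?X m) \<le> e" if "0 < e" for e
  proof (rule compact_eventually_ball[OF compact_julia])
    fix x assume x: "x \<in> ?J"
    have "\<forall>\<^sub>F m in sequentially. \<exists>w\<in>ball x (e / 2). (f ^^ m) w = a"
      using that by (intro eventually_hits_near_julia[OF x _ _ uv]) auto
    then have "\<forall>\<^sub>F m in sequentially. \<forall>y\<in>ball x (e / 2). infdist y (?X m) \<le> e"
    proof eventually_elim
      case (elim m)
      then obtain w where w: "w \<in> ball x (e / 2)" "w \<in> ?X m" by auto
      show ?case
      proof
        fix y assume "y \<in> ball x (e / 2)"
        then have "dist y w \<le> e"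
          using w(1) dist_triangle_half_r[of x y e w] by simp
        then show "infdist y (?X m) \<le> e"
          by (rule infdist_le2[OF w(2)])
      qed
    qed
    then show "\<exists>U. open U \<and> x \<in> U \<and> (\<forall>\<^sub>F m in sequentially. \<forall>y\<in>U. infdist y (?X m) \<le> e)"
      using that by (intro exI[of _ "ball x (e / 2)"]) simp
  qed
  have X_near: "\<forall>\<^sub>F m in sequentially. \<forall>x\<in>?X m. infdist x ?J \<le> e" if "0 < e" for e
  proof -
    \<comment> \<open>Beyond \<open>\<rho>\<close> an orbit never falls below its initial modulus,
      which exceeds \<open>norm a\<close>; all preimages of \<open>a\<close> therefore lie in this
      disc.\<close>
    define \<rho> where "\<rho> = max R (norm a)"
    \<comment> \<open>A point of \<open>L\<close> is neither interior nor on the frontier, hence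
      outside \<open>K\<close>.\<close>
    define L where "L = cball 0 \<rho> \<inter> (- interior K \<inter> {x. e \<le> infdist x ?J})"
    have "compact L"
      unfolding L_def
      by (intro compact_Int_closed closed_Int closed_Collect_le continuous_intros) auto
    then have "\<forall>\<^sub>F m in sequentially. \<forall>x\<in>L. (f ^^ m) x \<noteq> a"
    proof (rule compact_eventually_ball)
      fix x assume "x \<in> L"
      then have "x \<notin> interior K" "x \<notin> ?J"
        using that by (auto simp: L_def)
      then have "x \<notin> K"
        using closure_subset[of K] by (auto simp: frontier_def)
      then obtain U where U: "open U" "x \<in> U"
        "\<forall>B. \<forall>\<^sub>F n in sequentially. \<forall>w\<in>U. B < norm ((f ^^ n) w)"
        using escape_neighbourhood by blast
      have "\<forall>\<^sub>F m in sequentially. \<forall>y\<in>U. (f ^^ m) y \<noteq> a"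
        using spec[OF U(3), of "norm a"] by (rule eventually_mono) force
      then show "\<exists>U. open U \<and> x \<in> U \<and> (\<forall>\<^sub>F m in sequentially. \<forall>y\<in>U. (f ^^ m) y \<noteq> a)"
        using U by blast
    qed
    then show ?thesis
    proof eventually_elim
      case (elim m)
      show ?case
      proof
        fix x assume x: "x \<in> ?X m"
        have "x \<notin> interior K"
          using interior_filled_julia_funpow[of x m] x a by auto
        moreover have "norm x \<le> \<rho>"
        proof (rule ccontr)
          assume "\<not> norm x \<le> \<rho>"
          then have "R \<le> norm x" "norm a < norm x"
            by (auto simp: \<rho>_def)
          moreover have "1 * norm x \<le> 2 ^ m * norm x"
            by (intro mult_right_mono) simp_all
          ultimately show False
            using escape_funpow[of x m] x by simp
        qed
        ultimately show "infdist x ?J \<le> e"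
          using elim x by (force simp: L_def)
      qed
    qed
  qed
  have X_nonempty: "\<forall>\<^sub>F m in sequentially. ?X m \<noteq> {}"
  proof -
    obtain x where "x \<in> ?J" using J by blast
    from eventually_hits_near_julia[OF this open_UNIV _ uv]
    show ?thesis by (simp add: ex_in_conv[symmetric])
  qed
  have "(\<lambda>m. hausdorff_dist (?X m) ?J) \<longlonglongrightarrow> 0"
  proof (rule tendstoI)
    fix e :: real assume "0 < e"
    then have "0 < e / 2" by simp
    from J_near[OF this] X_near[OF this] X_nonempty
    show "\<forall>\<^sub>F m in sequentially. dist (hausdorff_dist (?X m) ?J) 0 < e"
    proof eventually_elim
      case (elim m)
      obtain x where "x \<in> ?J" using J by blast
      then have "0 \<le> hausdorff_dist ?J (?X m)"
        using infdist_le_hausdorff_dist[OF compact_julia elim(3)] infdist_nonneg by (meson order_trans)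
      moreover have "hausdorff_dist (?X m) ?J \<le> e / 2"
        unfolding hausdorff_dist_def using elim J by (intro max.boundedI cSUP_least) auto
      ultimately show ?case
        using \<open>0 < e\<close> by (simp add: hausdorff_dist_commute)
    qed
  qed
  then show ?thesis
    using J compact_julia by (simp add: hausdorff_tendsto_def)
qed

section \<open>Connectedness of the filled Julia set, its complement and its frontier\<close>

text \<open>A bounded component of the complement would have its frontier in \<open>K\<close>; by
  the maximum modulus principle all iterates would be bounded by \<open>R\<close> on it, putting it
  inside \<open>K\<close>. Outside a bounded set there is only one unbounded component.\<close>

lemma connected_Compl_filled_julia: "connected (- K)"
proof -
  have unbounded: "\<not> bounded C" if C: "C \<in> components (- K)" for C
  proof
    assume bounded: "bounded C"
    have fr: "frontier C \<subseteq> K"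
      by (rule frontier_of_components_closed_complement[OF closed_filled_julia C])
    have "norm ((f ^^ n) z) \<le> R" if z: "z \<in> C" for n z
    proof (rule maximum_modulus_frontier[OF _ _ bounded _ z])
      show "norm ((f ^^ n) w) \<le> R" if "w \<in> frontier C" for w
        using fr that mem_filled_julia_iff[of w] by (auto intro: less_imp_le)
    qed (intro holomorphic_funpow continuous_on_funpow)+
    then have "C \<subseteq> K"
      by (meson not_mem_filled_juliaE not_less subsetI)
    then show False
      using in_components_subset[OF C] in_components_nonempty[OF C] by blast
  qed
  have bounded: "bounded (- (- K))"
    using compact_filled_julia by (simp add: compact_imp_bounded)
  have "connected_component_set (- K) x = connected_component_set (- K) y" if "x \<in> - K" "y \<in> - K" for x y
    using that by (intro cobounded_unique_unbounded_component bounded unbounded)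
      (auto intro: componentsI)
  then show ?thesis
    by (metis connected_component_eq_self connected_connected_component connected_iff_connected_component
        connected_component_refl mem_Collect_eq)
qed

text \<open>The frontier of a component of the complement of a connected set is connected, and here
  the complement is a single component.\<close>

lemma connected_julia:
  assumes "connected K"
  shows "connected (frontier K)"
proof -
  have "- K \<noteq> {}"
    using filled_julia_neq_UNIV by blast
  then have "- K \<in> components (- K)"
    using components_eq_sing_iff[of "- K"] connected_Compl_filled_julia
    by simp
  from connected_frontier_component_complement[OF assms this] show ?thesis
    by (simp add: frontier_complement)
qed

text \<open>The Julia set separates the interior of \<open>K\<close> from the outside. Some
  component of it must then separate the plane, which a single point does not.\<close>

lemma not_totally_disconnected_julia:
  assumes "interior K \<noteq> {}"
  shows "\<not> totally_disconnected (frontier K)"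
proof
  assume td: "totally_disconnected (frontier K)"
  have "\<not> connected (- frontier K)"
  proof
    assume "connected (- frontier K)"
    moreover have "- frontier K \<inter> K \<noteq> {}"
      using assms interior_subset[of K] by (auto simp: frontier_def)
    moreover have "- frontier K - K \<noteq> {}"
      using filled_julia_neq_UNIV julia_subset by auto
    ultimately show False
      using connected_Int_frontier[of "- frontier K" K] by auto
  qed
  then obtain C where C: "C \<in> components (frontier K)" "\<not> connected (- C)"
    by (rule separation_by_component_closed[OF compact_imp_closed[OF compact_julia]])
  then obtain x where "C = {x}"
    using td by (auto simp: totally_disconnected_def)
  then show False
    using C(2) connected_punctured_universe[of x] by simp
qed

text \<open>Every component of the preimage of \<open>D\<close> is mapped onto \<open>D\<close>, hence contains a point over \<open>y\<close>.\<close>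

lemma connected_vimage:
  assumes D: "open D" "connected D" "D \<subseteq> ball 0 R"
    and I: "connected I" "I \<subseteq> f -` D" and y: "y \<in> D" "f -` {y} \<subseteq> I"
  shows "connected (f -` D)"
proof -
  have "open (f -` D)"
    using D(1) by (intro open_vimage holomorphic_on_imp_continuous_on hol)
  have bounded: "bounded (f -` D)"
  proof (rule bounded_subset[OF bounded_ball])
    show "f -` D \<subseteq> ball 0 R"
      using D(3) escape R_pos by (force simp: subset_iff not_le[symmetric])
  qed
  have image: "f ` C = D" if C: "C \<in> components (f -` D)" for C
  proof (rule ccontr)
    assume "f ` C \<noteq> D"
    have sub: "C \<subseteq> f -` D" and ne: "C \<noteq> {}"
      using C in_components_subset in_components_nonempty by blast+
    have "open C"
      using \<open>open (f -` D)\<close> C by (rule open_components)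
    then have "open (f ` C)"
      using open_mapping_thm[OF hol open_UNIV connected_UNIV _ _ not_constant] by simp
    have "D \<inter> f ` C \<noteq> {}" "D - f ` C \<noteq> {}"
      using sub ne \<open>f ` C \<noteq> D\<close> by auto
    \<comment> \<open>A missed boundary value \<open>v\<close> in \<open>D\<close> is attained on
      \<open>closure C\<close> by compactness. As \<open>C\<close> is relatively closed in the
      preimage, it is attained on \<open>C\<close> itself, contradicting openness of the
      image.\<close>
    then obtain v where v: "v \<in> D" "v \<in> frontier (f ` C)"
      using connected_Int_frontier[OF D(2), of "f ` C"] by auto
    have "compact (closure C)"
      using bounded_subset[OF bounded sub] by simp
    then have "compact (f ` closure C)"
      by (intro compact_continuous_image holomorphic_on_imp_continuous_on holomorphic_on_subset[OF hol]) auto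
    then have "closure (f ` C) \<subseteq> f ` closure C"
      by (intro closure_minimal compact_imp_closed image_mono closure_subset)
    then obtain x where x: "x \<in> closure C" "v = f x"
      using v(2) by (auto simp: frontier_def)
    obtain T where T: "closed T" "C = f -` D \<inter> T"
      using closedin_component[OF C] by (auto simp: closedin_closed)
    then have "closure C \<subseteq> T"
      by (intro closure_minimal) auto
    then have "x \<in> C"
      using x v(1) T(2) by auto
    then show False
      using v(2) x(2) \<open>open (f ` C)\<close> by (simp add: frontier_def interior_open)
  qed
  \<comment> \<open>The connected set \<open>I\<close> contains the whole fibre over
    \<open>y\<close>, so it meets and hence lies in every component; components sharing
    \<open>I\<close> coincide.\<close>
  have I_sub: "I \<noteq> {} \<and> I \<subseteq> C" if C: "C \<in> components (f -` D)" for C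
  proof -
    obtain x where "x \<in> C" "f x = y"
      using image[OF C] y(1) by (metis imageE)
    then have "x \<in> I" using y(2) by auto
    then show ?thesis
      using components_maximal[OF C I] \<open>x \<in> C\<close> by blast
  qed
  have "C = C'" if "C \<in> components (f -` D)" "C' \<in> components (f -` D)" for C C'
    using I_sub[OF that(1)] I_sub[OF that(2)] components_eq[OF that] by blast
  then consider "components (f -` D) = {}" | C where "components (f -` D) = {C}"
    by blast
  then show ?thesis
  proof cases
    case 1
    then show ?thesis by (simp add: components_eq_empty)
  next
    case 2
    then have "f -` D = C"
      using Union_components[of "f -` D"] by simp
    then show ?thesis
      using 2 in_components_connected[of C "f -` D"] by simp
  qed
qed

text \<open>\<open>K\<close> is the nested intersection of the compact closures of the iterated
  preimages of the disc, each connected by \<open>connected_vimage\<close>.\<close>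

lemma connected_filled_julia:
  assumes I: "connected I" "I \<subseteq> K" and y: "y \<in> I" "f -` {y} \<subseteq> I"
  shows "connected K"
proof -
  define D where "D n = (f ^^ n) -` ball 0 R" for n
  have mem_D: "z \<in> D n \<longleftrightarrow> norm ((f ^^ n) z) < R" for z n
    by (simp add: D_def)
  have D_Suc: "D (Suc n) = f -` D n" for n
    by (auto simp: mem_D funpow_Suc_right simp del: funpow.simps)
  have K_sub: "K \<subseteq> D n" for n
    by (auto simp: mem_D mem_filled_julia_iff)
  have step: "D (Suc n) \<subseteq> D n" for n
  proof
    fix z assume "z \<in> D (Suc n)"
    then show "z \<in> D n"
      using escape[of "(f ^^ n) z"] R_pos by (force simp: mem_D)
  qed
  then have anti: "D n \<subseteq> D m" if "m \<le> n" for m n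
    using that by (rule lift_Suc_antimono_le)
  then have D_ball: "D n \<subseteq> ball 0 R" for n
    using anti[of 0 n] by (simp add: D_def)
  have "connected (D n)" for n
  proof (induction n)
    case 0
    have "D 0 = ball 0 R" by (auto simp: mem_D)
    then show ?case by simp
  next
    case (Suc n)
    have "open (D n)"
      unfolding D_def by (intro open_vimage continuous_on_funpow) simp
    then have "connected (f -` D n)"
      using Suc D_ball I(1)
    proof (rule connected_vimage)
      show "I \<subseteq> f -` D n" "y \<in> D n"
        using I(2) K_sub[of "Suc n"] K_sub[of n] y(1) by (auto simp: D_Suc)
    qed (rule y(2))
    then show ?case by (simp add: D_Suc)
  qed
  then have "connected (\<Inter> (range (\<lambda>n. closure (D n))))"
  proof (intro connected_nest)
    show "compact (closure (D n))" for n
      using bounded_subset[OF bounded_ball D_ball] by simp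
  qed (use anti in \<open>simp_all add: connected_imp_connected_closure closure_mono\<close>)
  \<comment> \<open>Closure weakens the bound to at most \<open>R\<close>, which still excludes
    escaping points because they exceed \<open>R\<close> strictly at some time.\<close>
  moreover have "\<Inter> (range (\<lambda>n. closure (D n))) = K"
  proof (intro equalityI subsetI)
    fix z assume z: "z \<in> \<Inter> (range (\<lambda>n. closure (D n)))"
    have "norm ((f ^^ n) z) \<le> R" for n
    proof -
      have "closed {z. norm ((f ^^ n) z) \<le> R}"
        by (intro closed_Collect_le continuous_intros continuous_on_funpow)
      then have "closure (D n) \<subseteq> {z. norm ((f ^^ n) z) \<le> R}"
        by (intro closure_minimal) (auto simp: mem_D)
      then show ?thesis using z by auto
    qed
    then show "z \<in> K"
      by (meson not_le not_mem_filled_juliaE)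
  qed (use K_sub closure_subset in blast)
  ultimately show ?thesis by simp
qed

end

section \<open>Inverse branches of the cubic Chebyshev polynomial\<close>

text \<open>The inverse branches of \<open>u \<mapsto> u ^ 3 - 3 * u\<close>, from \<open>t + 1/t \<mapsto> t ^ 3 + 1/t ^ 3\<close>; the argument
  \<open>\<tau>\<close> of \<open>Ln\<close> satisfies \<open>\<tau> ^ 2 + 1/\<tau> ^ 2 = y\<close>.\<close>

definition cubic_branch :: "complex \<Rightarrow> complex \<Rightarrow> complex" where
  "cubic_branch \<omega> y =
    (let t = \<omega> * exp (2 / 3 * Ln ((csqrt (y - 2) + csqrt (y + 2)) / 2)) in t + inverse t)"

text \<open>A purely imaginary root would have a nonpositive real square.\<close>

lemma csqrt_Re_pos:
  assumes "z \<notin> \<real>\<^sub>\<le>\<^sub>0"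
  shows "0 < Re (csqrt z)"
proof (rule ccontr)
  assume "\<not> ?thesis"
  then have "Re (csqrt z) = 0"
    using csqrt_principal[of z] by simp
  then have "(csqrt z)\<^sup>2 = of_real (- (Im (csqrt z))\<^sup>2)"
    by (simp add: complex_eq_iff power2_eq_square del: csqrt.simps)
  then have "z = of_real (- (Im (csqrt z))\<^sup>2)"
    by (simp del: csqrt.simps)
  then show False
    using assms by (metis nonpos_Reals_of_real_iff neg_le_0_iff_le zero_le_power2)
qed

lemma joukowski_eq_iff:
  fixes s t :: "'a::field"
  assumes "s \<noteq> 0" "t \<noteq> 0"
  shows "s + inverse s = t + inverse t \<longleftrightarrow> s = t \<or> s = inverse t"
proof -
  have "(s - t) * (s * t - 1) = s * t * (s + inverse s - (t + inverse t))"
    using assms by (simp add: field_simps)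
  then have "s + inverse s = t + inverse t \<longleftrightarrow> (s - t) * (s * t - 1) = 0"
    using assms by auto
  also have "\<dots> \<longleftrightarrow> s = t \<or> s * t = 1"
    by simp
  also have "s * t = 1 \<longleftrightarrow> s = inverse t"
    using assms by (simp add: field_simps)
  finally show ?thesis .
qed

lemma joukowski_cubic:
  fixes t :: "'a::field"
  assumes "t \<noteq> 0"
  shows "(t + inverse t) ^ 3 - 3 * (t + inverse t) = t ^ 3 + inverse (t ^ 3)"
  using assms by (simp add: field_simps power3_eq_cube)

lemma joukowski_surj:
  fixes u :: complex
  obtains t where "t \<noteq> 0" "t + inverse t = u"
proof
  \<comment> \<open>A root of \<open>t^2 - u t + 1\<close>; the other root is \<open>u - t\<close>,
    its inverse.\<close>
  define t where "t = (u + csqrt (u\<^sup>2 - 4)) / 2"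
  have "2 * t - u = csqrt (u\<^sup>2 - 4)"
    by (simp add: t_def field_simps del: csqrt.simps)
  then have "(2 * t - u)\<^sup>2 = u\<^sup>2 - 4"
    by simp
  moreover have "4 * (t * (u - t)) = u\<^sup>2 - (2 * t - u)\<^sup>2"
    by (simp add: power2_eq_square algebra_simps)
  ultimately have eq: "t * (u - t) = 1"
    by simp
  then show "t \<noteq> 0" by auto
  then show "t + inverse t = u"
    using eq by (simp add: field_simps)
qed

context
  fixes y :: complex
  assumes slit: "y - 2 \<notin> \<real>\<^sub>\<le>\<^sub>0"
begin

lemma slit_plus_2: "y + 2 \<notin> \<real>\<^sub>\<le>\<^sub>0"
  using slit by (auto simp: complex_nonpos_Reals_iff)

text \<open>Keeps the argument of \<open>Ln\<close> off the branch cut, so that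
  \<open>cubic_branch\<close> is holomorphic off the slit.\<close>

lemma Re_cubic_branch_arg_pos: "0 < Re ((csqrt (y - 2) + csqrt (y + 2)) / 2)"
  using csqrt_Re_pos[OF slit] csqrt_Re_pos[OF slit_plus_2] by (simp del: csqrt.simps)

text \<open>The squares of the two roots differ by 4, so \<open>\<tau>\<close> has half their
  difference as inverse. With \<open>t ^ 3 = \<tau>\<^sup>2\<close>, the sum
  \<open>t ^ 3 + inverse (t ^ 3)\<close> is half the sum of the squares, which is
  \<open>y\<close>.\<close>

lemma cubic_branch_parameter:
  obtains t where "t \<noteq> 0" "t ^ 3 + inverse (t ^ 3) = y" "\<And>\<omega>. cubic_branch \<omega> y = \<omega> * t + inverse (\<omega> * t)"
proof
  let ?s = "csqrt (y - 2)" and ?r = "csqrt (y + 2)"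
  define \<tau> where "\<tau> = (?s + ?r) / 2"
  define t where "t = exp (2 / 3 * Ln \<tau>)"
  have \<tau>: "\<tau> \<noteq> 0"
    using Re_cubic_branch_arg_pos unfolding \<tau>_def by (metis less_irrefl zero_complex.sel(1))
  have "t ^ 3 = exp (of_nat 2 * Ln \<tau>)"
    by (simp add: t_def exp_of_nat_mult[symmetric])
  also have "\<dots> = \<tau>\<^sup>2"
    unfolding exp_of_nat_mult using \<tau> by simp
  finally have t3: "t ^ 3 = \<tau>\<^sup>2" .
  have "\<tau> * ((?r - ?s) / 2) = (?r\<^sup>2 - ?s\<^sup>2) / 4"
    unfolding \<tau>_def by (simp add: power2_eq_square algebra_simps del: power2_csqrt)
  then have "\<tau> * ((?r - ?s) / 2) = 1"
    by simp
  then have inv: "inverse \<tau> = (?r - ?s) / 2"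
    using \<tau> by (simp add: field_simps)
  have "\<tau>\<^sup>2 + (inverse \<tau>)\<^sup>2 = (?r\<^sup>2 + ?s\<^sup>2) / 2"
    unfolding inv unfolding \<tau>_def by (simp add: power2_eq_square field_simps del: power2_csqrt)
  then show "t ^ 3 + inverse (t ^ 3) = y"
    by (simp add: t3 power_inverse)
  show "t \<noteq> 0" by (simp add: t_def)
  show "cubic_branch \<omega> y = \<omega> * t + inverse (\<omega> * t)" for \<omega>
    by (simp add: cubic_branch_def t_def \<tau>_def Let_def)
qed

lemma cubic_branch_inverse:
  assumes "\<omega> ^ 3 = 1"
  shows "cubic_branch \<omega> y ^ 3 - 3 * cubic_branch \<omega> y = y"
proof -
  obtain t where t: "t \<noteq> 0" "t ^ 3 + inverse (t ^ 3) = y"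
      "\<And>\<omega>. cubic_branch \<omega> y = \<omega> * t + inverse (\<omega> * t)"
    by (rule cubic_branch_parameter) blast
  have "\<omega> \<noteq> 0" using assms by auto
  then show ?thesis
    using joukowski_cubic[of "\<omega> * t"] t assms by (simp only: t(3)) (simp add: power_mult_distrib)
qed

lemma cubic_branch_exhaust:
  assumes "u ^ 3 - 3 * u = y"
  obtains \<omega> where "\<omega> ^ 3 = 1" "u = cubic_branch \<omega> y"
proof -
  obtain t where t: "t \<noteq> 0" "t ^ 3 + inverse (t ^ 3) = y"
      "\<And>\<omega>. cubic_branch \<omega> y = \<omega> * t + inverse (\<omega> * t)"
    by (rule cubic_branch_parameter) blast
  obtain w where w: "w \<noteq> 0" "w + inverse w = u"
    by (rule joukowski_surj)
  have "w ^ 3 + inverse (w ^ 3) = t ^ 3 + inverse (t ^ 3)"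
    using joukowski_cubic[OF w(1)] w(2) assms t(2) by simp
  then consider "w ^ 3 = t ^ 3" | "w ^ 3 = inverse (t ^ 3)"
    using joukowski_eq_iff[of "w ^ 3" "t ^ 3"] w t by auto
  then show thesis
  proof cases
    case 1
    show thesis
      by (rule that[of "w / t"]) (use 1 w t in \<open>auto simp: power_divide inverse_eq_divide\<close>)
  next
    case 2
    \<comment> \<open>Replacing \<open>w\<close> by its inverse leaves \<open>u\<close> unchanged
      and reduces to the first case.\<close>
    show thesis
      by (rule that[of "inverse (w * t)"]) (use 2 w t in \<open>auto simp: power_mult_distrib power_inverse add.commute mult.assoc\<close>)
  qed
qed

text \<open>A coincidence with distinct parameters would make \<open>\<omega> * t\<close> and
  \<open>\<omega>' * t\<close> mutually inverse. Cubing gives \<open>t ^ 6 = 1\<close>, so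
  \<open>y\<close> is 2 or -2, and both lie on the slit.\<close>

lemma cubic_branch_inj:
  assumes \<omega>: "\<omega> ^ 3 = 1" "\<omega>' ^ 3 = 1" and eq: "cubic_branch \<omega> y = cubic_branch \<omega>' y"
  shows "\<omega> = \<omega>'"
proof -
  obtain t where t: "t \<noteq> 0" "t ^ 3 + inverse (t ^ 3) = y"
      "\<And>\<omega>. cubic_branch \<omega> y = \<omega> * t + inverse (\<omega> * t)"
    by (rule cubic_branch_parameter) blast
  have nz: "\<omega> \<noteq> 0" "\<omega>' \<noteq> 0" using \<omega> by auto
  then have "\<omega> * t = \<omega>' * t \<or> \<omega> * t = inverse (\<omega>' * t)"
    using joukowski_eq_iff[of "\<omega> * t" "\<omega>' * t"] eq t by simp
  moreover have "\<omega> * t \<noteq> inverse (\<omega>' * t)"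
  proof
    assume "\<omega> * t = inverse (\<omega>' * t)"
    then have "(\<omega> * t) ^ 3 = inverse (\<omega>' * t) ^ 3" by simp
    then have t3: "t ^ 3 = inverse (t ^ 3)"
      using \<omega> by (simp add: power_mult_distrib power_inverse)
    then have "(t ^ 3)\<^sup>2 = 1"
      using t(1) by (simp add: power2_eq_square field_simps)
    then have "t ^ 3 = 1 \<or> t ^ 3 = - 1"
      by (simp only: power2_eq_1_iff)
    then have "y = 2 \<or> y = - 2"
      using t(2) by auto
    then show False
      using slit by (auto simp: complex_nonpos_Reals_iff)
  qed
  ultimately show ?thesis
    using t(1) by simp
qed

end

lemma holomorphic_on_cubic_branch:
  assumes "f holomorphic_on S" "\<And>z. z \<in> S \<Longrightarrow> f z - 2 \<notin> \<real>\<^sub>\<le>\<^sub>0" "\<omega> \<noteq> 0"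
  shows "(\<lambda>z. cubic_branch \<omega> (f z)) holomorphic_on S"
proof -
  have "(csqrt (f z - 2) + csqrt (f z + 2)) / 2 \<notin> \<real>\<^sub>\<le>\<^sub>0" if "z \<in> S" for z
    using Re_cubic_branch_arg_pos[OF assms(2)[OF that]] by (auto simp: complex_nonpos_Reals_iff simp del: csqrt.simps)
  moreover have "f z + 2 \<notin> \<real>\<^sub>\<le>\<^sub>0" if "z \<in> S" for z
    using slit_plus_2[OF assms(2)[OF that]] .
  ultimately show ?thesis
    unfolding cubic_branch_def Let_def using assms
    by (intro holomorphic_intros holomorphic_on_csqrt') auto
qed

section \<open>Real cubics\<close>

text \<open>\<open>disc\<close> says that the derivative of the cubic has two distinct real zeros;
  \<open>1 < a1\<close> makes 0 a repelling fixed point.\<close>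

locale cubic =
  fixes a1 a2 a3 :: real
  assumes a1: "1 < a1" and a2: "0 < a2" and a3: "0 < a3"
    and disc: "3 * a1 * a3 < a2\<^sup>2"
begin

text \<open>Polymorphic, so that complex orbits of real points can be studied by order arguments
  over the reals.\<close>

definition p :: "'b::real_field \<Rightarrow> 'b" where
  "p z = of_real a1 * z + of_real a2 * z\<^sup>2 + of_real a3 * z ^ 3"

text \<open>From here on \<open>norm z\<close> is at least 1 and \<open>a3 * (norm z - 1)\<close> at
  least \<open>a1 + a2 + 2\<close>, which forces \<open>p z / z\<close> to have modulus at least
  2.\<close>

definition radius :: real where
  "radius = 1 + (a1 + a2 + 2) / a3"

lemma p_of_real: "p (of_real x :: 'b::real_field) = of_real (p x)"
  by (simp add: p_def)

lemma funpow_p_of_real: "(p ^^ n) (of_real x :: 'b::real_field) = of_real ((p ^^ n) x)"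
  by (induction n) (simp_all add: p_of_real)

lemma radius_pos: "0 < radius"
  using a1 a2 a3 by (simp add: radius_def add_pos_pos)

lemma p_escape:
  fixes z :: complex
  assumes "radius \<le> norm z"
  shows "2 * norm z \<le> norm (p z)"
proof -
  define x where "x = norm z"
  define q where "q = of_real a1 + of_real a2 * z + of_real a3 * z\<^sup>2"
  have "0 \<le> (a1 + a2 + 2) / a3" "(a1 + a2 + 2) / a3 \<le> x - 1"
    using assms a1 a2 a3 by (auto simp: x_def radius_def)
  then have x: "1 \<le> x" "a1 + a2 + 2 \<le> a3 * (x - 1)"
    using a3 by (linarith, simp add: field_simps)
  have "a3 * x\<^sup>2 = norm (q - of_real a1 - of_real a2 * z)"
    using a3 by (simp add: q_def x_def norm_mult norm_power)
  also have "\<dots> \<le> norm q + a1 + a2 * x"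
    using norm_triangle_ineq4[of "q - of_real a1" "of_real a2 * z"] norm_triangle_ineq4[of q "of_real a1"] a1 a2
    by (simp add: x_def norm_mult)
  finally have "a3 * x\<^sup>2 \<le> norm q + a1 + a2 * x" .
  moreover have "(a1 + 2) * 1 \<le> (a3 * (x - 1) - a2 + a3) * x"
    using x a1 a2 a3 by (intro mult_mono) auto
  then have "a1 + 2 \<le> a3 * x\<^sup>2 - a2 * x"
    by (simp add: power2_eq_square algebra_simps)
  ultimately have "2 \<le> norm q" by linarith
  then have "2 * x \<le> norm q * x"
    using x by (intro mult_right_mono) auto
  moreover have "p z = q * z"
    by (simp add: p_def q_def power2_eq_square power3_eq_cube algebra_simps)
  ultimately show ?thesis
    by (simp add: x_def norm_mult)
qed

sublocale escaping p radius
proof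
  show "(p :: complex \<Rightarrow> complex) holomorphic_on UNIV"
    unfolding p_def by (intro holomorphic_intros)
qed (use radius_pos p_escape in auto)

text \<open>Dividing \<open>p z - a\<close> by \<open>z - u\<close> leaves a quadratic with
  coefficients \<open>a3\<close>, \<open>B\<close>, \<open>C\<close>. If both its roots were
  \<open>u\<close>, the cubic would have a triple root, forcing \<open>a2^2 = 3 a1 a3\<close>
  against \<open>disc\<close>.\<close>

lemma two_preimages:
  fixes a :: complex
  obtains u v where "p u = a" "p v = a" "u \<noteq> v"
proof -
  have "\<exists>u. poly [:- a, of_real a1, of_real a2, of_real a3:] u = 0"
    using a3 by (intro fundamental_theorem_of_algebra_alt) auto
  then obtain u where u: "p u = a"
    by (auto simp: p_def power2_eq_square power3_eq_cube algebra_simps)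
  define B where "B = of_real a3 * u + of_real a2"
  define C where "C = of_real a3 * u\<^sup>2 + of_real a2 * u + of_real a1"
  define d where "d = csqrt (B\<^sup>2 - 4 * of_real a3 * C)"
  have d2: "d\<^sup>2 = B\<^sup>2 - 4 * of_real a3 * C"
    by (simp add: d_def)
  have root: "p v = a" if v: "2 * of_real a3 * v = - B + e" and e: "e\<^sup>2 = d\<^sup>2" for v e
  proof -
    have "4 * of_real a3 * (of_real a3 * v\<^sup>2 + B * v + C) = (2 * of_real a3 * v + B)\<^sup>2 - d\<^sup>2"
      unfolding d2 by (simp add: power2_eq_square algebra_simps)
    also have "\<dots> = 0"
      using v e by simp
    finally have "of_real a3 * v\<^sup>2 + B * v + C = 0"
      using a3 by simp
    moreover have "p v - p u = (v - u) * (of_real a3 * v\<^sup>2 + B * v + C)"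
      by (simp add: p_def B_def C_def power2_eq_square power3_eq_cube algebra_simps)
    ultimately show ?thesis using u by simp
  qed
  define v w where "v = (- B + d) / (2 * of_real a3)" and "w = (- B + - d) / (2 * of_real a3)"
  have vw: "2 * of_real a3 * v = - B + d" "2 * of_real a3 * w = - B + - d"
    using a3 by (simp_all add: v_def w_def)
  have "u \<noteq> v \<or> u \<noteq> w"
  proof (rule ccontr)
    assume "\<not> ?thesis"
    then have "u = v" "u = w" by auto
    then have "d = 0" "2 * of_real a3 * u = - B"
      using vw by auto
    then have "B\<^sup>2 = 4 * of_real a3 * C" and 1: "3 * of_real a3 * u = - of_real a2"
      using d2 by (auto simp: B_def algebra_simps)
    then have "(2 * of_real a3 * u)\<^sup>2 = 4 * of_real a3 * C"
      using \<open>2 * of_real a3 * u = - B\<close> by simp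
    then have "4 * of_real a3 * (of_real a2 * u + of_real a1) = 0"
      by (simp add: C_def power2_eq_square algebra_simps)
    then have "of_real a2 * u + of_real a1 = 0"
      using a3 by simp
    then have "of_real a2 * (3 * of_real a3 * u) + 3 * of_real a3 * of_real a1 = 0"
      using a3 by (metis (no_types, lifting) distrib_left mult.left_commute mult_zero_right)
    then have "complex_of_real (3 * a1 * a3 - a2\<^sup>2) = 0"
      unfolding 1 by (simp add: power2_eq_square algebra_simps)
    then show False
      using disc by (simp only: of_real_eq_0_iff)
  qed
  then show thesis
    using that[OF u root[OF vw(1)]] that[OF u root[OF vw(2)]] by auto
qed

lemma funpow_p_0: "(p ^^ n) 0 = (0 :: 'b::real_field)"
  by (induction n) (simp_all add: p_def)

lemma zero_mem_filled_julia: "0 \<in> K"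
  by (simp add: filled_julia_def funpow_p_0)

lemma hausdorff_tendsto_julia:
  assumes "a \<notin> interior K"
  shows "hausdorff_tendsto (\<lambda>m. {z. (p ^^ m) z = a}) (frontier K)"
proof -
  obtain u v where "p u = a" "p v = a" "u \<noteq> v"
    by (rule two_preimages)
  from hausdorff_tendsto_preimages[OF assms this] show ?thesis
    using zero_mem_filled_julia by blast
qed

lemma surj_p: "surj (p :: complex \<Rightarrow> complex)"
  unfolding surj_def
proof
  fix a :: complex
  obtain u v where "p u = a" "p v = a" "u \<noteq> v"
    by (rule two_preimages)
  then show "\<exists>x. a = p x" by blast
qed

lemma convergent_orbit_fixpoint:
  fixes x L :: real
  assumes "(\<lambda>n. (p ^^ n) x) \<longlonglongrightarrow> L"
  shows "p L = L"
proof -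
  have "(\<lambda>n. p ((p ^^ n) x)) \<longlonglongrightarrow> p L"
    unfolding p_def[of L] p_def[of "(p ^^ _) x"] by (intro tendsto_intros assms)
  moreover have "(\<lambda>n. p ((p ^^ n) x)) \<longlonglongrightarrow> L"
    using LIMSEQ_Suc[OF assms] by simp
  ultimately show ?thesis
    by (rule LIMSEQ_unique)
qed

lemma Bseq_real_orbit: "complex_of_real x \<in> K \<Longrightarrow> Bseq (\<lambda>n. (p ^^ n) x)"
  unfolding mem_filled_julia_iff funpow_p_of_real
  using radius_pos by (intro BseqI[of radius]) (auto intro: less_imp_le)

text \<open>A bounded orbit would decrease to a fixed point at most \<open>x\<close>, and there is
  none.\<close>

lemma decreasing_escapes:
  assumes "\<And>y::real. y \<le> x \<Longrightarrow> p y < y"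
  shows "complex_of_real x \<notin> K"
proof
  assume "complex_of_real x \<in> K"
  then have bdd: "Bseq (\<lambda>n. (p ^^ n) x)"
    by (rule Bseq_real_orbit)
  have le: "(p ^^ n) x \<le> x" for n
    by (induction n) (auto intro: order_trans[OF less_imp_le[OF assms]])
  have "monoseq (\<lambda>n. (p ^^ n) x)"
    unfolding monoseq_Suc using assms[OF le] by (auto intro: less_imp_le)
  then obtain L where L: "(\<lambda>n. (p ^^ n) x) \<longlonglongrightarrow> L"
    using Bseq_monoseq_convergent[OF bdd] by (auto simp: convergent_def)
  have "L \<le> x"
    using L le by (auto intro: LIMSEQ_le_const2)
  then show False
    using assms[of L] convergent_orbit_fixpoint[OF L] by simp
qed

lemma pos_escapes:
  fixes x :: real
  assumes "0 < x"
  shows "complex_of_real x \<notin> K"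
proof
  assume "complex_of_real x \<in> K"
  then have bdd: "Bseq (\<lambda>n. (p ^^ n) x)"
    by (rule Bseq_real_orbit)
  have gt: "y < p y" if "0 < y" for y :: real
  proof -
    have "1 * y < a1 * y"
      using a1 that by (intro mult_strict_right_mono) auto
    moreover have "0 < a2 * y\<^sup>2" "0 < a3 * y ^ 3"
      using a2 a3 that by simp_all
    ultimately show ?thesis
      by (simp add: p_def)
  qed
  have ge: "x \<le> (p ^^ n) x" for n
  proof (induction n)
    case (Suc n)
    then show ?case
      using gt[of "(p ^^ n) x"] assms by simp
  qed simp
  have "monoseq (\<lambda>n. (p ^^ n) x)"
    unfolding monoseq_Suc using gt less_le_trans[OF assms ge] by (auto intro: less_imp_le)
  then obtain L where L: "(\<lambda>n. (p ^^ n) x) \<longlonglongrightarrow> L"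
    using Bseq_monoseq_convergent[OF bdd] by (auto simp: convergent_def)
  have "x \<le> L"
    using L ge by (auto intro: LIMSEQ_le_const)
  then show False
    using gt[of L] assms convergent_orbit_fixpoint[OF L] by simp
qed

lemma zero_mem_julia: "0 \<in> frontier K"
proof -
  have "0 \<in> closure (- K)"
    unfolding closure_approachable
  proof (intro allI impI)
    fix e :: real assume "0 < e"
    then show "\<exists>y\<in>- K. dist y 0 < e"
      using pos_escapes[of "e / 2"] by (intro bexI[of _ "of_real (e / 2)"]) auto
  qed
  then show ?thesis
    using zero_mem_filled_julia closure_subset[of K] by (auto simp: frontier_closures)
qed

end

section \<open>Cubics without negative fixed points\<close>

context cubic
begin

text \<open>\<open>-shift\<close> is the inflection point and \<open>-shift\<close> plus or minus
  \<open>scale\<close> are the critical points. In the coordinate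
  \<open>u = (z + shift) / scale\<close> the cubic is
  \<open>gain * (u ^ 3 - 3 * u) + offset\<close>, to which \<open>cubic_branch\<close>
  applies.\<close>

definition shift :: real where "shift = a2 / (3 * a3)"
definition scale :: real where "scale = sqrt (shift\<^sup>2 - a1 / (3 * a3))"
definition gain :: real where "gain = a3 * scale ^ 3"
definition offset :: real where "offset = a3 * (3 * shift * scale\<^sup>2 - shift ^ 3)"

lemma a2_eq: "a2 = 3 * a3 * shift"
  using a3 by (simp add: shift_def)

lemma scale_pos: "0 < scale"
proof -
  have "a1 / (3 * a3) < shift\<^sup>2"
    using disc a3 by (simp add: shift_def power_divide power2_eq_square field_simps)
  then show ?thesis by (simp add: scale_def)
qed

lemma a1_eq: "a1 = 3 * a3 * (shift\<^sup>2 - scale\<^sup>2)"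
proof -
  have "scale\<^sup>2 = shift\<^sup>2 - a1 / (3 * a3)"
    using scale_pos by (simp add: scale_def)
  then show ?thesis
    using a3 by (simp add: field_simps)
qed

lemma gain_pos: "0 < gain"
  using a3 scale_pos by (simp add: gain_def)

lemma p_affine: "p (of_real scale * u - of_real shift) = of_real gain * (u ^ 3 - 3 * u) + of_real offset"
  for u :: "'b::real_field"
  unfolding p_def gain_def offset_def
  by (subst a1_eq, subst a2_eq) (simp add: power2_eq_square power3_eq_cube algebra_simps)

text \<open>The larger of the two critical values; \<open>-(scale + shift)\<close> is the smaller critical point.\<close>

definition crit_value :: real where "crit_value = p (- (scale + shift))"

lemma crit_value_eq: "crit_value = 2 * gain + offset"
  using p_affine[of "- 1 :: real"] by (simp add: crit_value_def)

lemma shift_pos: "0 < shift"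
  using a2 a3 by (simp add: shift_def)

text \<open>The removed ray contains both critical values, so three inverse branches exist here; the
  bounding disc makes their compositions uniformly bounded.\<close>

definition slit_disc :: "complex set" where
  "slit_disc = {y \<in> ball 0 radius. y - of_real crit_value \<notin> \<real>\<^sub>\<le>\<^sub>0}"

definition branch :: "complex \<Rightarrow> complex \<Rightarrow> complex" where
  "branch \<omega> y = of_real scale * cubic_branch \<omega> ((y - of_real offset) / of_real gain) - of_real shift"

lemma slit_normalized:
  assumes "y \<in> slit_disc"
  shows "(y - of_real offset) / of_real gain - 2 \<notin> \<real>\<^sub>\<le>\<^sub>0"
proof -
  have "(y - of_real offset) / of_real gain - 2 = (y - of_real crit_value) / of_real gain"
    using gain_pos by (simp add: crit_value_eq field_simps)
  then show ?thesis
    using assms gain_pos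
    by (auto simp: slit_disc_def complex_nonpos_Reals_iff divide_le_0_iff)
qed

lemma p_branch:
  assumes "y \<in> slit_disc" "\<omega> ^ 3 = 1"
  shows "p (branch \<omega> y) = y"
  using cubic_branch_inverse[OF slit_normalized[OF assms(1)] assms(2)] gain_pos
  by (simp add: branch_def p_affine)

lemma branch_exhaust:
  assumes "p z \<in> slit_disc"
  obtains \<omega> where "\<omega> ^ 3 = 1" "branch \<omega> (p z) = z"
proof -
  define u where "u = (z + of_real shift) / of_real scale"
  have z: "z = of_real scale * u - of_real shift"
    using scale_pos by (simp add: u_def)
  have "u ^ 3 - 3 * u = (p z - of_real offset) / of_real gain"
    using gain_pos unfolding z p_affine by simp
  then obtain \<omega> where \<omega>: "\<omega> ^ 3 = 1" "u = cubic_branch \<omega> ((p z - of_real offset) / of_real gain)"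
    using cubic_branch_exhaust[OF slit_normalized[OF assms]] by metis
  have "branch \<omega> (p z) = z"
    unfolding branch_def \<omega>(2)[symmetric] by (rule z[symmetric])
  with \<omega>(1) show thesis by (rule that)
qed

lemma branch_inj:
  assumes "y \<in> slit_disc" "\<omega> ^ 3 = 1" "\<omega>' ^ 3 = 1" "branch \<omega> y = branch \<omega>' y"
  shows "\<omega> = \<omega>'"
  using cubic_branch_inj[OF slit_normalized[OF assms(1)] assms(2,3)] assms(4) scale_pos
  by (simp add: branch_def)

lemma holomorphic_branch:
  assumes "\<omega> ^ 3 = 1"
  shows "branch \<omega> holomorphic_on slit_disc"
proof -
  have "\<omega> \<noteq> 0" using assms by auto
  then show ?thesis
    unfolding branch_def using gain_pos
    by (intro holomorphic_intros holomorphic_on_cubic_branch slit_normalized) auto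
qed

lemma open_slit_disc: "open slit_disc"
proof -
  have "open ((\<lambda>y. y - complex_of_real crit_value) -` (- \<real>\<^sub>\<le>\<^sub>0))"
    by (intro open_vimage continuous_intros) (simp_all add: open_Compl)
  moreover have "slit_disc = ball 0 radius \<inter> (\<lambda>y. y - of_real crit_value) -` (- \<real>\<^sub>\<le>\<^sub>0)"
    by (auto simp: slit_disc_def)
  ultimately show ?thesis by auto
qed

section \<open>Total disconnectedness when all negative reals move to the left\<close>

context
  assumes neg: "\<And>x::real. x < 0 \<Longrightarrow> p x < x"
begin

lemma crit_value_neg: "crit_value < 0"
  using neg[of "- (scale + shift)"] scale_pos shift_pos by (simp add: crit_value_def)

lemma neg_escapes: "x < 0 \<Longrightarrow> complex_of_real x \<notin> K"
  by (rule decreasing_escapes) (simp add: neg)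

text \<open>The slit lies on the negative axis and runs radially away from 0, so the region is
  starlike about 0.\<close>

lemma connected_slit_disc: "connected slit_disc"
proof (rule starlike_imp_connected, unfold starlike_def, intro bexI ballI subsetI)
  show "0 \<in> slit_disc"
    using crit_value_neg radius_pos by (simp add: slit_disc_def complex_nonpos_Reals_iff)
  fix z w assume z: "z \<in> slit_disc" and "w \<in> closed_segment 0 z"
  then obtain t where t: "0 \<le> t" "t \<le> 1" "w = t *\<^sub>R z"
    by (auto simp: closed_segment_def)
  have "norm w \<le> norm z"
    using t by (simp add: mult_left_le_one_le)
  moreover have "w - of_real crit_value \<notin> \<real>\<^sub>\<le>\<^sub>0"
  proof
    assume "w - of_real crit_value \<in> \<real>\<^sub>\<le>\<^sub>0"
    then have *: "t * Re z \<le> crit_value" "t * Im z = 0"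
      by (simp_all add: t complex_nonpos_Reals_iff)
    then have "t \<noteq> 0" "t * Re z < 0"
      using crit_value_neg by auto
    then have "Re z < 0"
      using t by (simp add: mult_less_0_iff)
    then have "1 * Re z \<le> t * Re z"
      using t by (intro mult_right_mono_neg) auto
    then have "z - of_real crit_value \<in> \<real>\<^sub>\<le>\<^sub>0"
      using * \<open>t \<noteq> 0\<close> by (simp add: complex_nonpos_Reals_iff)
    then show False
      using z by (simp add: slit_disc_def)
  qed
  ultimately show "w \<in> slit_disc"
    using z by (simp add: slit_disc_def)
qed

lemma slitE:
  assumes "z - of_real crit_value \<in> \<real>\<^sub>\<le>\<^sub>0"
  obtains x where "z = of_real x" "x \<le> crit_value" "x < 0"
proof -
  obtain r where r: "z - of_real crit_value = of_real r" "r \<le> 0"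
    using assms by (rule nonpos_Reals_cases)
  then have "z = of_real (r + crit_value)"
    by (simp add: algebra_simps)
  then show thesis
    using that[of "r + crit_value"] r(2) crit_value_neg by simp
qed

lemma filled_julia_subset_slit_disc: "K \<subseteq> slit_disc"
  using norm_filled_julia_less neg_escapes by (auto simp: slit_disc_def elim!: slitE)

text \<open>The complement is forward invariant: points outside the disc move outward, points of the
  slit move left along it. Hence the inverse branches map the region into itself and can be
  composed.\<close>

lemma slit_disc_backward: "p z \<in> slit_disc \<Longrightarrow> z \<in> slit_disc"
proof (rule ccontr)
  assume pz: "p z \<in> slit_disc" and z: "z \<notin> slit_disc"
  show False
  proof (cases "norm z < radius")
    case False
    then show False
      using escape[of z] pz radius_pos by (simp add: slit_disc_def)
  next
    case True
    then obtain x where x: "z = of_real x" "x \<le> crit_value" "x < 0"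
      using z by (auto simp: slit_disc_def elim: slitE)
    then have "p x \<le> crit_value"
      using neg[of x] by simp
    then show False
      using pz x(1) by (simp add: slit_disc_def p_of_real complex_nonpos_Reals_iff)
  qed
qed

text \<open>The sets where a given branch inverts \<open>p\<close> are closed in \<open>C\<close>,
  pairwise disjoint and finite in number, hence clopen; connectedness leaves just one.\<close>

lemma connected_branch:
  assumes C: "connected C" "C \<noteq> {}" "p ` C \<subseteq> slit_disc"
  obtains \<omega> where "\<omega> ^ 3 = 1" "\<forall>z\<in>C. branch \<omega> (p z) = z"
proof -
  define D where "D \<omega> = {z \<in> C. branch \<omega> (p z) = z}" for \<omega>
  let ?\<Omega> = "{\<omega>::complex. \<omega> ^ 3 = 1}"
  have closedin: "closedin (top_of_set C) (D \<omega>)" if "\<omega> \<in> ?\<Omega>" for \<omega>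
  proof -
    have "continuous_on C (\<lambda>z. branch \<omega> (p z) - z)"
      using that C(3)
      by (intro continuous_intros continuous_on_compose2[OF holomorphic_on_imp_continuous_on[OF holomorphic_branch]]
          holomorphic_on_imp_continuous_on holomorphic_on_subset[OF hol]) auto
    from continuous_closedin_preimage_constant[OF this, of 0] show ?thesis
      by (simp add: D_def)
  qed
  have fin: "finite ?\<Omega>" by (rule finite_roots_unity) simp
  have cover: "C = (\<Union>\<omega>\<in>?\<Omega>. D \<omega>)"
  proof (intro equalityI subsetI)
    fix z assume "z \<in> C"
    then obtain \<omega> where "\<omega> ^ 3 = 1" "branch \<omega> (p z) = z"
      using C(3) by (auto elim: branch_exhaust[of z])
    then show "z \<in> (\<Union>\<omega>\<in>?\<Omega>. D \<omega>)"
      using \<open>z \<in> C\<close> by (auto simp: D_def)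
  qed (auto simp: D_def)
  then obtain \<omega> where \<omega>: "\<omega> ^ 3 = 1" "D \<omega> \<noteq> {}"
    using C(2) by blast
  have disjoint: "D \<omega> \<inter> D \<omega>' = {}" if "\<omega>' ^ 3 = 1" "\<omega>' \<noteq> \<omega>" for \<omega>'
    using that \<omega>(1) C(3) branch_inj[of "p _" \<omega> \<omega>'] by (fastforce simp: D_def)
  have "C - D \<omega> = (\<Union>\<omega>'\<in>?\<Omega> - {\<omega>}. D \<omega>')"
  proof (intro equalityI subsetI)
    fix z assume "z \<in> C - D \<omega>"
    then show "z \<in> (\<Union>\<omega>'\<in>?\<Omega> - {\<omega>}. D \<omega>')"
      by (subst (asm) cover) auto
  next
    fix z assume "z \<in> (\<Union>\<omega>'\<in>?\<Omega> - {\<omega>}. D \<omega>')"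
    then obtain \<omega>' where "\<omega>' ^ 3 = 1" "\<omega>' \<noteq> \<omega>" "z \<in> D \<omega>'" by auto
    then show "z \<in> C - D \<omega>"
      using disjoint[of \<omega>'] by (auto simp: D_def)
  qed
  moreover have "closedin (top_of_set C) (\<Union>\<omega>'\<in>?\<Omega> - {\<omega>}. D \<omega>')"
    using fin closedin by (intro closedin_Union) auto
  ultimately have "openin (top_of_set C) (D \<omega>)"
    by (simp add: openin_closedin_eq D_def)
  then have "D \<omega> = C"
    using C(1) \<omega> closedin[of \<omega>] unfolding connected_clopen by blast
  then show thesis
    using that[OF \<omega>(1)] by (auto simp: D_def)
qed

text \<open>The n-th image of \<open>C\<close> is connected, so a single branch inverts
  \<open>p\<close> on it; composing these branches undoes the iterates along all of
  \<open>C\<close>.\<close>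

lemma connected_funpow_branch:
  assumes C: "connected C" "C \<noteq> {}" "C \<subseteq> K"
  shows "\<exists>h. h holomorphic_on slit_disc \<and> h ` slit_disc \<subseteq> slit_disc \<and>
    (\<forall>y\<in>slit_disc. (p ^^ n) (h y) = y) \<and> (\<forall>z\<in>C. h ((p ^^ n) z) = z)"
proof (induction n)
  case 0
  show ?case by (intro exI[of _ id]) auto
next
  case (Suc n)
  then obtain h where h: "h holomorphic_on slit_disc" "h ` slit_disc \<subseteq> slit_disc"
    "\<And>y. y \<in> slit_disc \<Longrightarrow> (p ^^ n) (h y) = y" "\<And>z. z \<in> C \<Longrightarrow> h ((p ^^ n) z) = z"
    by auto
  have "connected ((p ^^ n) ` C)"
    using C(1) by (intro connected_continuous_image continuous_on_funpow)
  moreover have "(p ^^ n) ` C \<noteq> {}"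
    using C(2) by simp
  moreover have "p ` (p ^^ n) ` C \<subseteq> K"
    using C(3) by (auto simp: filled_julia_step_iff funpow_filled_julia_iff)
  then have "p ` (p ^^ n) ` C \<subseteq> slit_disc"
    using filled_julia_subset_slit_disc by (rule order_trans)
  ultimately obtain \<omega> where \<omega>: "\<omega> ^ 3 = 1"
    "\<forall>z\<in>(p ^^ n) ` C. branch \<omega> (p z) = z"
    by (rule connected_branch)
  have maps: "branch \<omega> ` slit_disc \<subseteq> slit_disc"
  proof (rule image_subsetI, rule slit_disc_backward)
    show "p (branch \<omega> y) \<in> slit_disc" if "y \<in> slit_disc" for y
      using p_branch[OF that \<omega>(1)] that by simp
  qed
  show ?case
  proof (intro exI[of _ "h \<circ> branch \<omega>"] conjI ballI)
    show "(h \<circ> branch \<omega>) holomorphic_on slit_disc"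
      by (rule holomorphic_on_compose_gen[OF holomorphic_branch[OF \<omega>(1)] h(1) maps])
    show "(h \<circ> branch \<omega>) ` slit_disc \<subseteq> slit_disc"
      using maps h(2) by auto
    show "(p ^^ Suc n) ((h \<circ> branch \<omega>) y) = y" if "y \<in> slit_disc" for y
      using maps that h(3) p_branch[OF that \<omega>(1)] by auto
    show "(h \<circ> branch \<omega>) ((p ^^ Suc n) z) = z" if "z \<in> C" for z
      using \<omega>(2) h(4) that by simp
  qed
qed

text \<open>A nonconstant limit of inverse branches would be an open map sending a point to an escaping
  point near \<open>a \<in> C\<close>, although the inverse branches stay inverse to iterates that escape there.\<close>

lemma connected_subset_julia_trivial:
  assumes C: "connected C" "C \<subseteq> frontier K" and a: "a \<in> C" and b: "b \<in> C"
  shows "a = b"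
proof (rule ccontr)
  assume "a \<noteq> b"
  have "C \<noteq> {}" "C \<subseteq> K"
    using C a julia_subset by auto
  then have "\<forall>n. \<exists>h. h holomorphic_on slit_disc \<and> h ` slit_disc \<subseteq> slit_disc \<and>
    (\<forall>y\<in>slit_disc. (p ^^ n) (h y) = y) \<and> (\<forall>z\<in>C. h ((p ^^ n) z) = z)"
    using connected_funpow_branch[OF C(1)] by blast
  then obtain h where h: "\<And>n. h n holomorphic_on slit_disc" "\<And>n. h n ` slit_disc \<subseteq> slit_disc"
    "\<And>n y. y \<in> slit_disc \<Longrightarrow> (p ^^ n) (h n y) = y" "\<And>n z. z \<in> C \<Longrightarrow> h n ((p ^^ n) z) = z"
    by metis
  have "\<exists>g r. g holomorphic_on slit_disc \<and> strict_mono (r :: nat \<Rightarrow> nat) \<and>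
    (\<forall>x\<in>slit_disc. (\<lambda>n. h (r n) x) \<longlonglongrightarrow> g x) \<and> uniform_limit K (h \<circ> r) g sequentially"
    (is "?Q")
  \<comment> \<open>All \<open>h n\<close> take values in \<open>slit_disc\<close>, hence are
    bounded by \<open>radius\<close>. Uniform convergence is recorded on \<open>K\<close>, where the
    orbits of \<open>C\<close> stay.\<close>
  proof (rule Montel[OF open_slit_disc])
    show "k holomorphic_on slit_disc" if "k \<in> range h" for k
      using that h(1) by auto
    show "\<exists>B. \<forall>k\<in>range h. \<forall>z\<in>L. norm (k z) \<le> B" if "L \<subseteq> slit_disc" for L
      using that h(2) by (intro exI[of _ radius]) (force simp: slit_disc_def intro: less_imp_le)
    show "range h \<subseteq> range h" ..
    show ?Q if "g holomorphic_on slit_disc" "strict_mono (r :: nat \<Rightarrow> nat)"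
      "\<And>x. x \<in> slit_disc \<Longrightarrow> (\<lambda>n. h (r n) x) \<longlonglongrightarrow> g x"
      "\<And>L. \<lbrakk>compact L; L \<subseteq> slit_disc\<rbrakk> \<Longrightarrow> uniform_limit L (h \<circ> r) g sequentially" for g r
      using that(1-3) that(4)[OF compact_filled_julia filled_julia_subset_slit_disc] by blast
  qed
  then obtain g r where g: "g holomorphic_on slit_disc" and r: "strict_mono (r :: nat \<Rightarrow> nat)"
    and lim: "\<And>x. x \<in> slit_disc \<Longrightarrow> (\<lambda>n. h (r n) x) \<longlonglongrightarrow> g x"
    and ulim: "uniform_limit K (h \<circ> r) g sequentially"
    by blast
  note Ksub = filled_julia_subset_slit_disc
  \<comment> \<open>Each \<open>z\<close> in \<open>C\<close> is the value of \<open>h (r n)\<close>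
    at a point of \<open>K\<close>, so values of \<open>g\<close> on \<open>K\<close> come
    arbitrarily close to \<open>z\<close>, and compactness makes \<open>z\<close> such a value. Two
    points of \<open>C\<close> thus make \<open>g\<close> nonconstant.\<close>
  have in_image: "z \<in> g ` K" if "z \<in> C" for z
  proof -
    have "compact (g ` K)"
      by (intro compact_continuous_image compact_filled_julia
          holomorphic_on_imp_continuous_on holomorphic_on_subset[OF g Ksub])
    moreover have "z \<in> closure (g ` K)"
      unfolding closure_approachable
    proof (intro allI impI)
      fix e :: real assume "0 < e"
      then have "\<forall>\<^sub>F n in sequentially. \<forall>x\<in>K. dist (h (r n) x) (g x) < e"
        using ulim by (auto simp: uniform_limit_iff)
      then obtain n where n: "\<forall>x\<in>K. dist (h (r n) x) (g x) < e"
        using eventually_happens by fastforce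
      have "(p ^^ r n) z \<in> K"
        using that \<open>C \<subseteq> K\<close> by (auto simp: funpow_filled_julia_iff)
      then show "\<exists>y\<in>g ` K. dist y z < e"
        using n h(4)[OF that, of "r n"] by (force simp: dist_commute)
    qed
    ultimately show ?thesis
      using closure_closed compact_imp_closed by blast
  qed
  have "\<not> g constant_on slit_disc"
    using in_image[OF a] in_image[OF b] Ksub \<open>a \<noteq> b\<close>
    unfolding constant_on_def by (metis imageE subsetD)
  then have "open (g ` slit_disc)"
    using open_mapping_thm[OF g open_slit_disc connected_slit_disc open_slit_disc] by simp
  moreover have "a \<in> g ` slit_disc"
    using in_image[OF a] Ksub by blast
  ultimately obtain w where "w \<in> g ` slit_disc" "w \<notin> K"
    using escaping_near_julia[of a "g ` slit_disc"] a C(2) by blast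
  then obtain x where x: "x \<in> slit_disc" "g x \<notin> K"
    by blast
  obtain V where V: "open V" "g x \<in> V" "\<forall>B. \<forall>\<^sub>F n in sequentially. \<forall>w\<in>V. B < norm ((p ^^ n) w)"
    using escape_neighbourhood[OF x(2)] by blast
  have "\<forall>\<^sub>F n in sequentially. \<forall>w\<in>V. radius < norm ((p ^^ r n) w)"
    using filterlim_subseq[OF r] spec[OF V(3), of radius] by (rule eventually_compose_filterlim[rotated])
  moreover have "\<forall>\<^sub>F n in sequentially. h (r n) x \<in> V"
    using lim[OF x(1)] V(1,2) by (rule topological_tendstoD)
  ultimately have "\<forall>\<^sub>F n in sequentially. False"
  proof eventually_elim
    case (elim n)
    then show False
      using h(3)[OF x(1), of "r n"] x(1) by (force simp: slit_disc_def)
  qed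
  then show False by simp
qed

lemma totally_disconnected_julia: "totally_disconnected (frontier K)"
  unfolding totally_disconnected_def
proof
  fix C assume C: "C \<in> components (frontier K)"
  then obtain a where a: "a \<in> C"
    using in_components_nonempty by blast
  then have "C = {a}"
    using connected_subset_julia_trivial[OF in_components_connected[OF C] in_components_subset[OF C] a]
    by blast
  then show "\<exists>x. C = {x}" ..
qed

end

end

section \<open>Cubics with a parabolic fixed point\<close>

locale parabolic_cubic = cubic +
  assumes double: "a2\<^sup>2 = 4 * a3 * (a1 - 1)"
begin

text \<open>\<open>-s\<close> is the double root of \<open>(p z - z) / z\<close>, so a fixed point
  of multiplier 1.\<close>

definition s :: real where "s = a2 / (2 * a3)"

lemma s_pos: "0 < s"
  using a2 a3 by (simp add: s_def)

lemma a2_eq_s: "a2 = 2 * a3 * s"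
  using a3 by (simp add: s_def)

lemma a1_eq_s: "a1 = 1 + a3 * s\<^sup>2"
proof -
  have "4 * a3 * (a3 * s\<^sup>2) = (2 * a3 * s)\<^sup>2"
    by (simp add: power2_eq_square)
  then have "4 * a3 * (a3 * s\<^sup>2) = 4 * a3 * (a1 - 1)"
    by (simp only: a2_eq_s[symmetric] double)
  then show ?thesis
    using a3 by simp
qed

lemma p_eq_s: "p z = z + of_real a3 * z * (z + of_real s)\<^sup>2" for z :: "'b::real_field"
  unfolding p_def by (subst a1_eq_s, subst a2_eq_s)
    (simp add: power2_eq_square power3_eq_cube algebra_simps)

lemma less_neg_s_escapes:
  assumes "x < - s"
  shows "complex_of_real x \<notin> K"
proof (rule decreasing_escapes)
  fix y assume "y \<le> x"
  then have "y < 0" "0 < (y + s)\<^sup>2"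
    using assms s_pos by auto
  then show "p y < y"
    using a3 by (simp add: p_eq_s mult_pos_neg mult_neg_pos)
qed

lemma neg_s_mem_filled_julia: "- complex_of_real s \<in> K"
proof -
  have "(p ^^ n) (- complex_of_real s) = - complex_of_real s" for n
    by (induction n) (simp_all add: p_eq_s)
  then show ?thesis
    by (simp add: filled_julia_def)
qed

lemma le_neg_s_not_interior:
  assumes "x \<le> - s"
  shows "complex_of_real x \<notin> interior K"
proof
  assume "complex_of_real x \<in> interior K"
  then obtain e where e: "0 < e" "ball (complex_of_real x) e \<subseteq> K"
    by (auto simp: mem_interior)
  have "complex_of_real (x - e / 2) \<in> ball (complex_of_real x) e"
    using e(1) by (simp add: dist_norm)
  then have "complex_of_real (x - e / 2) \<in> K"
    using e(2) by blast
  then show False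
    using less_neg_s_escapes[of "x - e / 2"] e(1) assms by simp
qed

lemma neg_s_mem_julia: "- complex_of_real s \<in> frontier K"
  using le_neg_s_not_interior[of "- s"] neg_s_mem_filled_julia closure_subset[of K]
  by (auto simp: frontier_def)

text \<open>Here \<open>a3 * s\<^sup>2 = 4\<close>, so \<open>p z + s\<close> factors as
  \<open>a3 (z + s) (z + s/2)^2\<close>. The fibre over \<open>-s\<close> is
  \<open>{-s, -s/2}\<close>, inside the invariant segment \<open>I\<close>, and
  \<open>connected_filled_julia\<close> applies.\<close>

lemma connected_julia_critical:
  assumes "a1 = 5"
  shows "connected (frontier K)"
proof -
  have a3s: "a3 * s\<^sup>2 = 4"
    using a1_eq_s assms by simp
  define I where "I = complex_of_real ` {- s..0}"
  have p_I: "p x \<in> {- s..0}" if "x \<in> {- s..0}" for x :: real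
  proof -
    have x: "x \<le> 0" "0 \<le> x + s"
      using that by auto
    have "a3 * x * (x + s)\<^sup>2 \<le> 0"
      using x a3 by (intro mult_nonpos_nonneg mult_nonneg_nonpos) auto
    moreover have "p x + s = (x + s) * (1 + a3 * (x * (x + s)))"
      by (simp add: p_eq_s power2_eq_square algebra_simps)
    moreover have "1 + a3 * (x * (x + s)) = a3 * (x + s / 2)\<^sup>2"
      using a3s by (simp add: power2_eq_square algebra_simps)
    then have "0 \<le> (x + s) * (1 + a3 * (x * (x + s)))"
      using a3 x by simp
    ultimately show ?thesis
      using x by (simp add: p_eq_s)
  qed
  have orbit: "(p ^^ n) x \<in> {- s..0}" if "x \<in> {- s..0}" for x :: real and n
    using that by (induction n) (simp_all add: p_I del: atLeastAtMost_iff)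
  have I_K: "I \<subseteq> K"
  proof (clarsimp simp: I_def simp del: atLeastAtMost_iff)
    fix x :: real assume x: "x \<in> {- s..0}"
    have "norm ((p ^^ n) (complex_of_real x)) \<le> s" for n
      using orbit[OF x, of n] by (simp add: funpow_p_of_real)
    then show "complex_of_real x \<in> K"
      by (auto simp: filled_julia_def bounded_iff)
  qed
  have conn: "connected I"
    unfolding I_def by (intro connected_continuous_image continuous_intros) simp
  have "- complex_of_real s \<in> I"
    using s_pos by (auto simp: I_def intro!: image_eqI[of _ _ "- s"])
  moreover have "p -` {- complex_of_real s} \<subseteq> I"
  proof
    fix z :: complex assume "z \<in> p -` {- complex_of_real s}"
    then have "p z + of_real s = 0" by simp
    moreover have "p z + of_real s = (z + of_real s) * (1 + of_real a3 * (z * (z + of_real s)))"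
      by (simp add: p_eq_s power2_eq_square algebra_simps)
    moreover have "1 + of_real a3 * (z * (z + of_real s)) = of_real a3 * (z + of_real (s / 2))\<^sup>2"
    proof -
      have "of_real a3 * (z + of_real (s / 2))\<^sup>2 = of_real a3 * (z * (z + of_real s)) + of_real (a3 * s\<^sup>2) / 4"
        by (simp add: power2_eq_square algebra_simps)
      then show ?thesis by (simp add: a3s)
    qed
    ultimately have "z + of_real s = 0 \<or> z + of_real (s / 2) = 0"
      using a3 by auto
    then have "z = of_real (- s) \<or> z = of_real (- (s / 2))"
      by (auto simp: eq_neg_iff_add_eq_0)
    then obtain x where x: "z = of_real x" "x = - s \<or> x = - (s / 2)"
      by blast
    then have "x \<in> {- s..0}"
      using s_pos by auto
    then show "z \<in> I"
      unfolding I_def x(1) by (rule imageI)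
  qed
  ultimately have "connected K"
    by (rule connected_filled_julia[OF conn I_K])
  then show ?thesis
    by (rule connected_julia)
qed

text \<open>The larger critical point escapes, and a branch of the hyperbola on which \<open>p\<close> is real passes
  through it. That branch is mapped into the escaping ray, so it separates the two points \<open>-s\<close>
  and \<open>0\<close> of the Julia set.\<close>

lemma not_connected_julia:
  assumes "5 < a1"
  shows "\<not> connected (frontier K)"
proof
  assume conn: "connected (frontier K)"
  have a3s: "4 < a3 * s\<^sup>2"
    using a1_eq_s assms by simp
  \<comment> \<open>Off the real axis, \<open>p z\<close> is real exactly when
    \<open>(Im z)\<^sup>2 = g (Re z)\<close>. \<open>W\<close> is the part inside this hyperbola to
    the right of \<open>-s/2\<close>.\<close>
  define g where "g x = 3 * x\<^sup>2 + 4 * s * x + s\<^sup>2 + 1 / a3" for x :: real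
  define W where "W = {z. - s / 2 < Re z \<and> (Im z)\<^sup>2 < g (Re z)}"
  define W' where "W' = {z. - s / 2 \<le> Re z \<and> (Im z)\<^sup>2 \<le> g (Re z)}"
  have "W = {z. - s / 2 < Re z} \<inter> {z. (Im z)\<^sup>2 < g (Re z)}"
    by (auto simp: W_def)
  moreover have "open {z. - s / 2 < Re z}" "open {z. (Im z)\<^sup>2 < g (Re z)}"
    unfolding g_def by (intro open_Collect_less continuous_intros)+
  ultimately have "open W" by auto
  have "W' = {z. - s / 2 \<le> Re z} \<inter> {z. (Im z)\<^sup>2 \<le> g (Re z)}"
    by (auto simp: W'_def)
  moreover have "closed {z. - s / 2 \<le> Re z}" "closed {z. (Im z)\<^sup>2 \<le> g (Re z)}"
    unfolding g_def by (intro closed_Collect_le continuous_intros)+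
  ultimately have "closed W'" by auto
  then have "closure W \<subseteq> W'"
    by (intro closure_minimal) (auto simp: W_def W'_def)
  then have frontier_W: "frontier W \<subseteq> W' - W"
    using \<open>open W\<close> by (auto simp: frontier_def interior_open)
  have escapes: "z \<notin> K" if "z \<in> W' - W" for z
  proof -
    define x y where "x = Re z" and "y = Im z"
    have xy: "- s / 2 \<le> x" "y\<^sup>2 \<le> g x" "- s / 2 = x \<or> y\<^sup>2 = g x"
      using that by (auto simp: W_def W'_def x_def y_def)
    \<comment> \<open>This uses \<open>5 < a1\<close>: the vertical line through \<open>-s/2\<close>
      misses \<open>W'\<close>, so the frontier of \<open>W\<close> lies on the hyperbola
      alone.\<close>
    have "g (- s / 2) < 0"
      using a3 a3s by (simp add: g_def power2_eq_square field_simps)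
    then have "- s / 2 < x"
      using xy(1,2) by (metis le_less less_le_trans not_less zero_le_power2)
    then have y2: "y\<^sup>2 = 3 * x\<^sup>2 + 4 * s * x + s\<^sup>2 + 1 / a3"
      using xy(3) by (auto simp: g_def)
    have a3y2: "a3 * y\<^sup>2 = 3 * (a3 * x\<^sup>2) + 4 * (a3 * s * x) + a3 * s\<^sup>2 + 1"
      unfolding y2 using a3 by (simp add: field_simps)
    have z: "z = Complex x y"
      by (simp add: x_def y_def)
    \<comment> \<open>The value of \<open>p\<close> on the hyperbola, after eliminating
      \<open>y\<close>. It is at most \<open>-2 (x + s)\<close>, which is below \<open>-s\<close>
      since \<open>x > -s/2\<close>.\<close>
    define v where "v = - (2 * (x + s) * (a3 * (2 * x + s)\<^sup>2 + 1))"
    have "Im (p z) = y * (1 + 3 * (a3 * x\<^sup>2) + 4 * (a3 * s * x) + a3 * s\<^sup>2 - a3 * y\<^sup>2)"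
      unfolding p_eq_s z by (simp add: power2_eq_square algebra_simps)
    then have "Im (p z) = 0"
      unfolding a3y2 by simp
    moreover have "Re (p z) = x + a3 * (x * (x + s)\<^sup>2) - (3 * x + 2 * s) * (a3 * y\<^sup>2)"
      unfolding p_eq_s z by (simp add: power2_eq_square algebra_simps)
    then have "Re (p z) = v"
      unfolding a3y2 v_def by (simp add: power2_eq_square algebra_simps)
    ultimately have pz: "p z = of_real v"
      by (simp add: complex_eq_iff)
    have "2 * (x + s) * 1 \<le> - v"
      unfolding v_def minus_minus
      using a3 \<open>- s / 2 < x\<close> s_pos by (intro mult_left_mono) auto
    then have "2 * x + 2 * s \<le> - v"
      by simp
    moreover have "- s < 2 * x"
      using \<open>- s / 2 < x\<close> by simp
    ultimately have "v < - s"
      by linarith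
    then have "p z \<notin> K"
      unfolding pz by (rule less_neg_s_escapes)
    then show ?thesis
      by (simp add: filled_julia_step_iff)
  qed
  have "0 \<in> frontier K \<inter> W"
    using zero_mem_julia s_pos a3 by (simp add: W_def g_def add_pos_pos)
  moreover have "- complex_of_real s \<in> frontier K - W"
    using neg_s_mem_julia s_pos by (simp add: W_def)
  ultimately have "frontier K \<inter> frontier W \<noteq> {}"
    using connected_Int_frontier[OF conn, of W] by blast
  then show False
    using frontier_W escapes julia_subset by blast
qed

text \<open>In the coordinate \<open>1/(z + s)\<close> the map is a translation by about \<open>a3 s > 0\<close> near infinity,
  so it preserves a right half plane.\<close>

lemma interior_filled_julia_nonempty: "interior K \<noteq> {}"
proof -
  \<comment> \<open>With \<open>u = z + s\<close> one has \<open>p z + s = u * N u\<close>, and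
    \<open>1/(u * N u) - 1/u = a3 * (s - u) / N u\<close>, which is close to \<open>a3 * s\<close>
    for small \<open>u\<close>.\<close>
  define N where "N u = 1 - of_real (a3 * s) * u + of_real a3 * u\<^sup>2" for u :: complex
  have N0: "N 0 = 1" by (simp add: N_def)
  have cont_N: "isCont N 0"
    unfolding N_def by (auto intro!: continuous_intros)
  have cont: "isCont (\<lambda>u. Re ((of_real s - u) / N u)) 0"
    using cont_N N0 by (auto intro!: continuous_intros)
  have "\<forall>\<^sub>F u in nhds 0. N u \<noteq> 0"
    using cont_N N0 by (intro tendsto_imp_eventually_ne[of _ 1]) (auto simp: isCont_def tendsto_nhds_iff)
  moreover have "\<forall>\<^sub>F u in nhds 0. 0 < Re ((of_real s - u) / N u)"
    using cont N0 s_pos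
    by (intro order_tendstoD(1)[of _ s]) (auto simp: isCont_def tendsto_nhds_iff)
  ultimately have "\<forall>\<^sub>F u in nhds 0. N u \<noteq> 0 \<and> 0 < Re ((of_real s - u) / N u)"
    by (rule eventually_conj)
  then obtain d where d: "0 < d"
    and small: "\<And>u. norm u < d \<Longrightarrow> N u \<noteq> 0 \<and> 0 < Re ((of_real s - u) / N u)"
    by (auto simp: eventually_nhds_metric)
  \<comment> \<open>The attracting petal: a disc with \<open>-s\<close> on its boundary, the
    preimage of a half plane under \<open>1/(z + s)\<close>. It is small enough for the estimate on
    \<open>N\<close>.\<close>
  define E where "E = {z. 1 / d < Re (1 / (z + complex_of_real s))}"
  have E: "z + of_real s \<noteq> 0" "norm (z + of_real s) < d" if "z \<in> E" for z
  proof -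
    show nz: "z + of_real s \<noteq> 0"
      using that d by (auto simp: E_def)
    have "1 / d < norm (1 / (z + of_real s))"
      using that complex_Re_le_cmod[of "1 / (z + of_real s)"] by (auto simp: E_def)
    then show "norm (z + of_real s) < d"
      using nz d by (simp add: norm_divide field_simps)
  qed
  have step: "p z \<in> E" if "z \<in> E" for z
  proof -
    define u where "u = z + of_real s"
    have u: "u \<noteq> 0" "N u \<noteq> 0" "0 < Re ((of_real s - u) / N u)"
      using E[OF that] small[of u] by (auto simp: u_def)
    have Re_mult: "Re (of_real a3 * w) = a3 * Re w" for w
      by simp
    have pu: "p z + of_real s = u * N u"
      by (simp add: p_eq_s u_def N_def power2_eq_square algebra_simps)
    have "1 / (u * N u) = 1 / u + of_real a3 * ((of_real s - u) / N u)"
      using u by (simp add: field_simps) (simp add: N_def power2_eq_square algebra_simps)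
    then have "Re (1 / (p z + of_real s)) = Re (1 / u) + a3 * Re ((of_real s - u) / N u)"
      unfolding pu by (simp only: plus_complex.sel Re_mult)
    moreover have "1 / d < Re (1 / u)"
      using that by (simp add: E_def u_def)
    moreover have "0 < a3 * Re ((of_real s - u) / N u)"
      using a3 u(3) by (rule mult_pos_pos)
    ultimately show ?thesis
      unfolding E_def mem_Collect_eq by linarith
  qed
  have "E \<subseteq> K"
  proof
    fix z assume "z \<in> E"
    then have "(p ^^ n) z \<in> E" for n
      by (induction n) (simp_all add: step)
    then have "norm ((p ^^ n) z) \<le> d + s" for n
      using E(2)[of "(p ^^ n) z"] norm_triangle_ineq4[of "(p ^^ n) z + of_real s" "of_real s"] s_pos
      by fastforce
    then show "z \<in> K"
      by (auto simp: filled_julia_def bounded_iff)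
  qed
  moreover have "open E"
  proof -
    have "open (- {- complex_of_real s} \<inter> (\<lambda>z. Re (1 / (z + complex_of_real s))) -` {1 / d<..})"
      by (intro continuous_open_preimage continuous_intros) (auto simp: eq_neg_iff_add_eq_0)
    moreover have "E = - {- complex_of_real s} \<inter> (\<lambda>z. Re (1 / (z + complex_of_real s))) -` {1 / d<..}"
      using d by (auto simp: E_def)
    ultimately show ?thesis by simp
  qed
  moreover have "of_real (d / 2 - s) \<in> E"
    using d by (simp add: E_def field_simps)
  ultimately show ?thesis
    using interior_maximal[of E K] by blast
qed

end

section \<open>The independence attractor\<close>

lemma independence_attractorI:
  assumes "hausdorff_tendsto (\<lambda>m. Roots (independence_poly (lex_power G m))) A"
    and "\<And>m. compact (Roots (independence_poly (lex_power G m)))"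
    and "\<And>m. Roots (independence_poly (lex_power G m)) \<noteq> {}"
  shows "has_independence_attractor G" "independence_attractor G = A"
proof -
  show "has_independence_attractor G"
    using assms(1) by (auto simp: has_independence_attractor_def)
  show "independence_attractor G = A"
    unfolding independence_attractor_def
    using assms(1) hausdorff_tendsto_unique[OF _ assms(1) assms(2,3)] by (rule the_equality)
qed

text \<open>The roots are the iterated preimages of -1. That they form finite nonempty sets makes
  the Hausdorff limit unique, so the definite description denotes it.\<close>

lemma (in cubic) independence_attractor_eq_julia:
  fixes G :: "'a pair_pre_digraph"
  assumes G: "pair_graph G"
    and poly_G: "independence_poly G = [:1, of_real a1, of_real a2, of_real a3:]"
    and base: "- 1 \<notin> interior K"
  shows "has_independence_attractor G" "independence_attractor G = frontier K"
proof -
  interpret pair_graph G by (rule G)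
  have p_eq: "(\<lambda>z. poly (independence_poly G) z - 1) = p"
    by (rule ext) (simp add: poly_G p_def power2_eq_square power3_eq_cube algebra_simps)
  have Roots_eq: "Roots (independence_poly (lex_power G m)) = {z. (p ^^ m) z = - 1}" for m
    by (simp add: Roots_def poly_independence_poly_lex_power[OF pair_finite_verts] p_eq
        eq_neg_iff_add_eq_0)
  have nonempty: "{z. (p ^^ m) z = - (1 :: complex)} \<noteq> {}" for m
    using surj_fn[OF surj_p, of m] by (metis (mono_tags, lifting) empty_Collect_eq surjD)
  have "compact {z. (p ^^ m) z = - (1 :: complex)}" for m
  proof -
    \<comment> \<open>The constant coefficient is 1, so the polynomial is nonzero.\<close>
    have "poly (independence_poly (lex_power G m)) 0 \<noteq> 0"
      by (simp add: poly_independence_poly_lex_power[OF pair_finite_verts] p_eq funpow_p_0)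
    then have "finite (Roots (independence_poly (lex_power G m)))"
      unfolding Roots_def by (intro poly_roots_finite) auto
    then show ?thesis
      by (simp add: Roots_eq finite_imp_compact)
  qed
  then show "has_independence_attractor G" "independence_attractor G = frontier K"
    using independence_attractorI[of G "frontier K"] hausdorff_tendsto_julia[OF base] nonempty
    unfolding Roots_eq by blast+
qed

text \<open>\<open>s = a2 / (2 a3)\<close> and \<open>a2\<close> is even, so either \<open>s \<le> 1\<close>, or \<open>a2 - 2 a3 \<ge> 2\<close> and then \<open>p\<close> maps
  \<open>-1\<close> to the left of the parabolic point \<open>-s\<close>.\<close>

lemma (in parabolic_cubic) minus_one_not_interior:
  fixes m n :: nat
  assumes m: "a2 = of_nat m" and n: "a3 = of_nat n" and "even m"
  shows "- 1 \<notin> interior K"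
proof (cases "s \<le> 1")
  case True
  then show ?thesis
    using le_neg_s_not_interior[of "- 1"] by simp
next
  case False
  then have "2 * a3 < a2"
    using a3 by (simp add: s_def not_le)
  then have "real (2 * n) < real m"
    by (simp add: m n)
  then have "2 * n < m"
    by (simp only: of_nat_less_iff)
  then have "2 * n + 2 \<le> m"
    using \<open>even m\<close> by presburger
  then have "real (2 * n + 2) \<le> real m"
    by (simp only: of_nat_le_iff)
  then have "2 * a3 + 2 \<le> a2"
    by (simp add: m n)
  then have "1 + a3 - a3 * s \<le> 0"
    using a3 by (simp add: s_def field_simps)
  moreover have "p (- 1) + s = (s - 1) * (1 + a3 - a3 * s)"
    by (simp add: p_eq_s power2_eq_square algebra_simps)
  ultimately have "p (- 1 :: real) + s \<le> 0"
    using False by (simp add: mult_nonneg_nonpos)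
  then have "complex_of_real (p (- 1)) \<notin> interior K"
    by (intro le_neg_s_not_interior) simp
  then have "p (- 1 :: complex) \<notin> interior K"
    using p_of_real[of "- 1", where 'b = complex] by simp
  then show ?thesis
    using interior_filled_julia_step by blast
qed

theorem theorem1p3:
  fixes G :: "'a pair_pre_digraph" and a1 a2 a3 :: nat
  assumes "pair_graph G"
    and "independence_number G = 3"
    and "independence_poly G = [:1, of_nat a1, of_nat a2, of_nat a3:]"
    and "(real a2)\<^sup>2 > 3 * real a1 * real a3"
  shows "((real a2)\<^sup>2 < 4 * real a3 * (real a1 - 1) \<longrightarrow>
           has_independence_attractor G \<and> totally_disconnected (independence_attractor G)) \<and>
         ((real a2)\<^sup>2 = 4 * real a3 * (real a1 - 1) \<longrightarrow>
           has_independence_attractor G \<and>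
           (a1 = 5 \<longrightarrow> connected (independence_attractor G)) \<and>
           (a1 \<noteq> 5 \<longrightarrow> \<not> connected (independence_attractor G) \<and>
                       \<not> totally_disconnected (independence_attractor G)))"
proof -
  have "0 \<le> 3 * real a1 * real a3"
    by simp
  then have "0 < (real a2)\<^sup>2"
    using assms(4) by (rule le_less_trans)
  then have a2: "0 < a2"
    by simp
  have cubic: "cubic (real a1) (real a2) (real a3)"
    if "(real a2)\<^sup>2 \<le> 4 * real a3 * (real a1 - 1)"
  proof
    have "0 < real a3 * (real a1 - 1)"
      using that \<open>0 < (real a2)\<^sup>2\<close> by linarith
    then have "0 < real a3" "0 < real a1 - 1"
      by (auto simp: zero_less_mult_iff)
    then show "1 < real a1" "0 < real a3" by simp_all
  qed (use a2 assms(4) in simp_all)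
  have poly_G: "independence_poly G = [:1, of_real (real a1), of_real (real a2), of_real (real a3):]"
    using assms(3) by simp
  have less: "has_independence_attractor G \<and> totally_disconnected (independence_attractor G)"
    if less: "(real a2)\<^sup>2 < 4 * real a3 * (real a1 - 1)"
  proof -
    interpret cubic "real a1" "real a2" "real a3"
      using less by (intro cubic) simp
    \<comment> \<open>Completing the square: the quadratic \<open>(p x - x) / x\<close> has negative
      discriminant and is positive everywhere.\<close>
    have neg: "p x < x" if "x < 0" for x :: real
    proof -
      have "0 < (2 * real a3 * x + real a2)\<^sup>2 + (4 * real a3 * (real a1 - 1) - (real a2)\<^sup>2)"
        using less by (intro add_nonneg_pos) simp_all
      also have "\<dots> = 4 * real a3 * (real a1 - 1 + real a2 * x + real a3 * x\<^sup>2)"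
        by (simp add: power2_eq_square algebra_simps)
      finally have "0 < real a1 - 1 + real a2 * x + real a3 * x\<^sup>2"
        using a3 by (simp add: zero_less_mult_iff)
      then have "x * (real a1 - 1 + real a2 * x + real a3 * x\<^sup>2) < 0"
        using that by (simp add: mult_neg_pos)
      then show ?thesis
        by (simp add: p_def power2_eq_square power3_eq_cube algebra_simps)
    qed
    have "- 1 \<notin> interior K"
      using neg_escapes[OF neg, of "- 1"] interior_subset[of K] by auto
    from independence_attractor_eq_julia[OF assms(1) poly_G this] show ?thesis
      using totally_disconnected_julia[OF neg] by simp
  qed
  have equal: "has_independence_attractor G \<and>
      (a1 = 5 \<longrightarrow> connected (independence_attractor G)) \<and>
      (a1 \<noteq> 5 \<longrightarrow> \<not> connected (independence_attractor G) \<and>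
        \<not> totally_disconnected (independence_attractor G))"
    if eq: "(real a2)\<^sup>2 = 4 * real a3 * (real a1 - 1)"
  proof -
    interpret cubic "real a1" "real a2" "real a3"
      using eq by (intro cubic) simp
    interpret parabolic_cubic "real a1" "real a2" "real a3"
      using eq by unfold_locales
    \<comment> \<open>The two conditions on \<open>a2^2\<close> combine to
      \<open>3 a1 < 4 (a1 - 1)\<close>, that is \<open>a1 > 4\<close>.\<close>
    have "real a3 * (3 * real a1) < real a3 * (4 * (real a1 - 1))"
      using assms(4) eq by (simp add: mult_ac)
    then have "5 \<le> a1"
      using a3 by simp
    \<comment> \<open>Read over the naturals, the equation shows that \<open>a2\<close> is even, as
      the parity argument for -1 requires.\<close>
    have "real (a2\<^sup>2) = real (4 * a3 * (a1 - 1))"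
      using eq \<open>5 \<le> a1\<close> by (simp add: of_nat_diff)
    then have "a2\<^sup>2 = 4 * a3 * (a1 - 1)"
      by (simp only: of_nat_eq_iff)
    then have "even (a2\<^sup>2)" by simp
    then have "even a2" by simp
    then have "- 1 \<notin> interior K"
      by (intro minus_one_not_interior[OF refl refl])
    note attractor = independence_attractor_eq_julia[OF assms(1) poly_G this]
    show ?thesis
      using attractor connected_julia_critical not_connected_julia \<open>5 \<le> a1\<close>
        not_totally_disconnected_julia[OF interior_filled_julia_nonempty] by auto
  qed
  show ?thesis
    using less equal by blast
qed

end
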